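(* Let $T\ge 2$ be an integer and $p\in(0,1)$. Let $\{U_n\}_{n\ge 0}$ be a sequence of independent random variables with $U_{kT}=1$ almost surely for all $k\ge 0$ and $U_n$ Bernoulli with parameter $p$ for every $n\ge 0$ that is not a multiple of $T$. Let $\{X_n\}_{n\ge 0}$ be a strictly stationary sequence of positive random variables with continuous marginal distribution function $F$, independent of $\{U_n\}_{n\ge 0}$. Define $$Y_n=U_nX_n+(1-U_n)\max_{[(n-1)/T]\,T\le i\le n-1}U_iX_i,\qquad n\ge 1 .$$ Let $\{u_n\}_{n\ge1}$ be a sequence of positive real numbers with $$n(1-F(u_n))\to\tau_{\mathbf X}\in(0,\infty),\qquad n(1-G_j(u_n))\to\tau_j\quad (2\le j\le T-1),$$ where $G_j$ is the distribution function of $\max_{0\le i\le j-1}U_iX_i$ (the second requirement being void for $T=2$), and set $$\tau=\frac1T\Big\{((T-2)p+2)\tau_{\mathbf X}+(1-p)\sum_{j=2}^{T-1}\tau_j\Big\}.$$ Assume that $\{X_n\}$ and $\{Y_n\}$ satisfy condition $D(u_n)$ with a sequence $\ell_n=o(n)$, that $\{k_n\}$ is a sequence of positive integers with $k_n\to+\infty$, $k_n\ell_n/n\to0$, $k_n\alpha_{n,\ell_n}\to0$ (for the mixing coefficients $\alpha_{n,\ell_n}$ of both sequences), that $\{X_n\}$ has extremal index $\theta_{\mathbf X}$, and that $$nP\Big(\max_{0\le j\le T}X_j>u_n\ge X_{T+1},\ M^{(\mathbf X)}_{T+2,\,[\frac{n}{k_nT}]T+T}>u_n\Big)\longrightarrow0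 .$$ Then, whenever the limits defining the $P_{i,T}$ below exist, the extremal index of $\{Y_n\}$ is $$\theta_{\mathbf Y}=\frac{\tau_{\mathbf X}}{\tau T}\,\theta_{\mathbf X}\big((T-1)p^{T}+p^{T-1}\big)+\frac1{\tau T}\sum_{i=1}^{T-1}P_{i,T},$$ where $$\begin{aligned}P_{i,T}={}&\lim_{n\to+\infty}n\sum_{I\subsetneq\overline S_i}P\big(X_i>u_n,\ M^{(\mathbf X)}(S_i\cup I)\le u_n\big)\,p^{|I|+T-i}(1-p)^{i-|I|}\\&+\lim_{n\to+\infty}n\sum_{J\subseteq\underline S_i}\ \sum_{I\subseteq\overline S_i}P\big(M^{(\mathbf X)}(J\cup\{0\})>u_n,\ M^{(\mathbf X)}(S_i\cup I)\le u_n\big)\,p^{|I|+|J|+T-i-1}(1-p)^{2i-|I|-|J|},\end{aligned}$$ with $S_i=\{i+1,\dots,T\}$, $\overline S_i=\{T+1,\dots,T+i\}$ for $1\le i\le T-1$, $\underline S_1=\emptyset$ and $\underline S_i=\{1,\dots,i-1\}$ for $2\le i\le T-1$.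
   Context: $[a]$ denotes the integer part of $a$. For a sequence $\mathbf W=\{W_n\}$ of random variables, $M^{(\mathbf W)}_{i,j}=\max_{i\le m\le j}W_m$ for $i\le j$, $M^{(\mathbf W)}_{i,j}=-\infty$ for $i>j$, and $M^{(\mathbf W)}(B)=\max_{m\in B}W_m$ for a finite set $B$ of indices. Sums over $I\subsetneq\overline S_i$ run over all proper subsets (including $\emptyset$); sums over $I\subseteq\overline S_i$, $J\subseteq\underline S_i$ run over all subsets. Condition $D(u_n)$ for $\mathbf W$: there is a sequence $\ell_n=o(n)$ such that $\alpha_{n,\ell_n}\to0$, where $\alpha_{n,\ell_n}$ is the supremum of $|P(M^{(\mathbf W)}_{i_1,i_1+a}\le u_n, M^{(\mathbf W)}_{j_1,j_1+b}\le u_n)-P(M^{(\mathbf W)}_{i_1,i_1+a}\le u_n)P(M^{(\mathbf W)}_{j_1,j_1+b}\le u_n)|$ over all integers with $1\le i_1<i_1+a+\ell_n\le j_1<j_1+b\le n$. Extremal indices: $\theta_{\mathbf X}=-\frac1{\tau_{\mathbf X}}\log\lim_{n}P(M^{(\mathbf X)}_{1,n}\le u_n)$; and $\theta_{\mathbf Y}=-\frac1\tau\log\lim_{n}P(M^{(\mathbf Y)}_{1,n}\le u_n)$, where $\tau=\lim_n \frac nT\sum_{j=1}^T P(Y_j>u_n)$, which equals the $\tau$ given in the claim. *)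

theory Defs
  imports "HOL-Probability.Probability" "HOL-Library.Landau_Symbols"
begin

text \<open>The maximum of \<open>W m\<close> over a finite index set \<open>B\<close>; in the complete order \<^typ>\<open>ereal\<close> the
  maximum over the empty set is \<open>-\<infinity>\<close>, and \<open>M_{i,j}\<close> is the case \<open>B = {i..j}\<close>.\<close>

definition seq_max :: "(nat \<Rightarrow> 'w \<Rightarrow> real) \<Rightarrow> nat set \<Rightarrow> 'w \<Rightarrow> ereal" where
  "seq_max W B \<omega> = (SUP m\<in>B. ereal (W m \<omega>))"

definition strictly_stationary :: "'w measure \<Rightarrow> (nat \<Rightarrow> 'w \<Rightarrow> real) \<Rightarrow> bool" where
  "strictly_stationary M W \<longleftrightarrow>
     (\<forall>n. W n \<in> borel_measurable M) \<and>
     (\<forall>J h. finite J \<longrightarrow>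
        distr M (PiM J (\<lambda>_. borel)) (\<lambda>\<omega>. \<lambda>j\<in>J. W (j + h) \<omega>) =
        distr M (PiM J (\<lambda>_. borel)) (\<lambda>\<omega>. \<lambda>j\<in>J. W j \<omega>))"

text \<open>The supremum is over a nonempty set as soon as \<open>l + 3 \<le> n\<close>, hence for almost all \<open>n\<close> if
  \<open>l = l_n = o(n)\<close>; its values for other \<open>n\<close> are irrelevant. Negative \<open>a\<close> are left out, since the
  first maximum is then \<open>-\<infinity>\<close> and the difference is 0.\<close>

definition mixing_coeff ::
    "'w measure \<Rightarrow> (nat \<Rightarrow> 'w \<Rightarrow> real) \<Rightarrow> (nat \<Rightarrow> real) \<Rightarrow> nat \<Rightarrow> nat \<Rightarrow> real" where
  "mixing_coeff M W u n l =
     Sup {\<bar>\<P>(\<omega> in M. seq_max W {i..i + a} \<omega> \<le> ereal (u n) \<and> seq_max W {j..j + b} \<omega> \<le> ereal (u n))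
           - \<P>(\<omega> in M. seq_max W {i..i + a} \<omega> \<le> ereal (u n))
             * \<P>(\<omega> in M. seq_max W {j..j + b} \<omega> \<le> ereal (u n))\<bar>
         | i a j b. 1 \<le> i \<and> i < i + a + l \<and> i + a + l \<le> j \<and> j < j + b \<and> j + b \<le> n}"

text \<open>Condition \<open>D(u_n)\<close>, satisfied with the given sequence \<open>l_n\<close>.\<close>

definition condition_D_with ::
    "'w measure \<Rightarrow> (nat \<Rightarrow> 'w \<Rightarrow> real) \<Rightarrow> (nat \<Rightarrow> real) \<Rightarrow> (nat \<Rightarrow> nat) \<Rightarrow> bool" where
  "condition_D_with M W u l \<longleftrightarrow>
     (\<lambda>n. real (l n)) \<in> o(\<lambda>n. real n) \<and>
     (\<lambda>n. mixing_coeff M W u n (l n)) \<longlonglongrightarrow> 0"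

text \<open>The extremal index for levels \<open>u_n\<close> whose normalised mean number of exceedances tends to
  \<open>\<tau>\<close>. The limit \<open>L\<close> has to be positive for its logarithm to exist.\<close>

definition has_extremal_index ::
    "'w measure \<Rightarrow> (nat \<Rightarrow> 'w \<Rightarrow> real) \<Rightarrow> (nat \<Rightarrow> real) \<Rightarrow> real \<Rightarrow> real \<Rightarrow> bool" where
  "has_extremal_index M W u \<tau> \<theta> \<longleftrightarrow>
     (\<exists>L>0. (\<lambda>n. \<P>(\<omega> in M. seq_max W {1..n} \<omega> \<le> ereal (u n))) \<longlonglongrightarrow> L \<and> \<theta> = - (1 / \<tau>) * ln L)"

text \<open>The sequence \<open>Y_n\<close>, meant for \<open>n \<ge> 1\<close> only.\<close>

definition failure_seq ::
    "nat \<Rightarrow> (nat \<Rightarrow> 'w \<Rightarrow> real) \<Rightarrow> (nat \<Rightarrow> 'w \<Rightarrow> real) \<Rightarrow> nat \<Rightarrow> 'w \<Rightarrow> real" where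
  "failure_seq T U X n \<omega> =
     U n \<omega> * X n \<omega> +
     (1 - U n \<omega>) * Max ((\<lambda>i. U i \<omega> * X i \<omega>) ` {(n - 1) div T * T..n - 1})"

definition S_mid :: "nat \<Rightarrow> nat \<Rightarrow> nat set" where "S_mid T i = {i + 1..T}"
definition S_over :: "nat \<Rightarrow> nat \<Rightarrow> nat set" where "S_over T i = {T + 1..T + i}"
definition S_under :: "nat \<Rightarrow> nat set" where "S_under i = {1..i - 1}"

text \<open>The two sequences whose limits add up to \<open>P_{i,T}\<close>. No exponent is truncated, since
  \<open>|I| \<le> i\<close>, \<open>|J| \<le> i - 1\<close> and \<open>i < T\<close>.\<close>

definition P_seq1 ::
    "'w measure \<Rightarrow> (nat \<Rightarrow> 'w \<Rightarrow> real) \<Rightarrow> (nat \<Rightarrow> real) \<Rightarrow> real \<Rightarrow> nat \<Rightarrow> nat \<Rightarrow> nat \<Rightarrow> real" where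
  "P_seq1 M X u p T i n =
     real n * (\<Sum>I\<in>{I. I \<subset> S_over T i}.
       \<P>(\<omega> in M. X i \<omega> > u n \<and> seq_max X (S_mid T i \<union> I) \<omega> \<le> ereal (u n))
       * p ^ (card I + T - i) * (1 - p) ^ (i - card I))"

definition P_seq2 ::
    "'w measure \<Rightarrow> (nat \<Rightarrow> 'w \<Rightarrow> real) \<Rightarrow> (nat \<Rightarrow> real) \<Rightarrow> real \<Rightarrow> nat \<Rightarrow> nat \<Rightarrow> nat \<Rightarrow> real" where
  "P_seq2 M X u p T i n =
     real n * (\<Sum>J\<in>Pow (S_under i). \<Sum>I\<in>Pow (S_over T i).
       \<P>(\<omega> in M. seq_max X (J \<union> {0}) \<omega> > ereal (u n) \<and> seq_max X (S_mid T i \<union> I) \<omega> \<le> ereal (u n))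
       * p ^ (card I + card J + T - i - 1) * (1 - p) ^ (2 * i - card I - card J))"

definition P_lim ::
    "'w measure \<Rightarrow> (nat \<Rightarrow> 'w \<Rightarrow> real) \<Rightarrow> (nat \<Rightarrow> real) \<Rightarrow> real \<Rightarrow> nat \<Rightarrow> nat \<Rightarrow> real" where
  "P_lim M X u p T i = lim (P_seq1 M X u p T i) + lim (P_seq2 M X u p T i)"

end

theory Submission
  imports Defs
begin

text \<open>Cut \<open>{1..n}\<close> into \<open>k_n\<close> blocks of length \<open>r = [n/(k_n T)] T\<close>. Condition \<open>D(u_n)\<close> makes the block
  maxima asymptotically independent, so \<open>P(M_{1,n} \<le> u_n)\<close> tends to \<open>exp (- s)\<close> iff
  \<open>k_n P(M_{1,r} > u_n)\<close> tends to \<open>s\<close>. An exceedance within a block is counted by the last one, and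
  the local condition shows that up to \<open>o(1/k_n)\<close> the last exceedances are those
  followed by \<open>T\<close> non-exceedances. As the sequences are stationary under shifts by \<open>T\<close>, both
  extremal indices are thus governed by \<open>n/T\<close> times the sum over \<open>1 \<le> i \<le> T\<close> of
  \<open>P(W_i > u_n, M_{i+1,i+T} \<le> u_n)\<close>. For \<open>W = X\<close> this limit is \<open>\<tau>X \<theta>X\<close>. For \<open>W = Y\<close> one conditions
  on the values of \<open>U\<close> within two periods: each \<open>i < T\<close> contributes the two sums in \<open>P_{i,T}\<close>, where the
  index set \<open>I\<close> missing from the first one (no failure at all) gives \<open>p^T \<tau>X \<theta>X\<close>, and
  \<open>i = T\<close> contributes \<open>p^(T-1) \<tau>X \<theta>X\<close>.\<close>

text \<open>The law of \<open>Y\<close> is only invariant under shifts by multiples of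
  \<open>T\<close>, because a failure looks back to the last multiple of \<open>T\<close>. The
  locale \<open>blocks\<close> therefore asks for no more invariance than this, stated for patterns
  of exceedances, and both sequences are instances of it. A run of \<open>T\<close> non-exceedances
  is the right separation: it contains a multiple of \<open>T\<close>, where \<open>Y\<close> agrees
  with \<open>X\<close> and forgets the past, so exceedances of \<open>Y\<close> before and after it
  come from exceedances of \<open>X\<close> separated by a non-exceedance. In this way the local
  condition, which speaks of \<open>X\<close>, also controls \<open>Y\<close>.

  At a level \<open>u n > 0\<close> all events depend on two random sets only: the indices with
  \<open>X i > u n\<close> and those with \<open>U i = 1\<close>. The combinatorics of failures is
  done for deterministic sets, and probabilities follow by summing over the finitely many patterns
  of the second set. The block argument also needs \<open>k n / n\<close> to tend to 0, which has to
  be extracted from the hypotheses on \<open>l\<close> and on the mixing coefficient of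
  \<open>X\<close>.\<close>

lemma seq_max_le_iff: "seq_max W B \<omega> \<le> ereal c \<longleftrightarrow> (\<forall>m\<in>B. W m \<omega> \<le> c)"
  by (simp add: seq_max_def SUP_le_iff)

lemma less_seq_max_iff: "ereal c < seq_max W B \<omega> \<longleftrightarrow> (\<exists>m\<in>B. c < W m \<omega>)"
  by (simp add: seq_max_def less_SUP_iff)

section \<open>Block maxima and run ends\<close>

text \<open>A finite index set has finitely many patterns, so for arbitrary \<open>Q\<close> the
  event is a finite union of pattern events. Later events can thus be arbitrary functions of
  patterns and still be measurable.\<close>

lemma pred_finite_pattern:
  assumes "finite J" and [measurable]: "\<And>j. j \<in> J \<Longrightarrow> Measurable.pred M (P j)"
  shows "Measurable.pred M (\<lambda>\<omega>. Q {j \<in> J. P j \<omega>})"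
proof -
  have "(\<lambda>\<omega>. Q {j \<in> J. P j \<omega>}) = (\<lambda>\<omega>. \<exists>E\<in>Pow J. Q E \<and> (\<forall>j\<in>J. P j \<omega> \<longleftrightarrow> j \<in> E))"
  proof (rule ext, rule iffI)
    fix \<omega> assume "Q {j \<in> J. P j \<omega>}"
    then show "\<exists>E\<in>Pow J. Q E \<and> (\<forall>j\<in>J. P j \<omega> \<longleftrightarrow> j \<in> E)"
      by (intro bexI[of _ "{j \<in> J. P j \<omega>}"]) auto
  next
    fix \<omega> assume "\<exists>E\<in>Pow J. Q E \<and> (\<forall>j\<in>J. P j \<omega> \<longleftrightarrow> j \<in> E)"
    then obtain E where "E \<subseteq> J" "Q E" "\<forall>j\<in>J. P j \<omega> \<longleftrightarrow> j \<in> E" by auto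
    moreover from this have "{j \<in> J. P j \<omega>} = E" by auto
    ultimately show "Q {j \<in> J. P j \<omega>}" by simp
  qed
  moreover have "Measurable.pred M (\<lambda>\<omega>. \<exists>E\<in>Pow J. Q E \<and> (\<forall>j\<in>J. P j \<omega> \<longleftrightarrow> j \<in> E))"
    using assms(1) by (intro pred_intros_finite finite_Pow_iff[THEN iffD2]) measurable
  ultimately show ?thesis by simp
qed

text \<open>With \<open>y = - k ln (1 - a)\<close> the power is \<open>exp (- y)\<close>, and
  \<open>k a \<le> y \<le> k a / (1 - a)\<close> by \<open>ln x \<le> x - 1\<close> applied to
  \<open>1 - a\<close> and to its inverse. Since \<open>a\<close> tends to 0, \<open>y\<close> and
  \<open>k a\<close> have the same limit.\<close>

lemma power_near_exp_iff:
  fixes a :: "nat \<Rightarrow> real" and k :: "nat \<Rightarrow> nat"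
  assumes a0: "a \<longlonglongrightarrow> 0" and nn: "\<And>n. 0 \<le> a n"
  shows "(\<lambda>n. (1 - a n) ^ k n) \<longlonglongrightarrow> exp (- s) \<longleftrightarrow> (\<lambda>n. real (k n) * a n) \<longlonglongrightarrow> s"
proof -
  define y where "y = (\<lambda>n. - (real (k n) * ln (1 - a n)))"
  have ev: "\<forall>\<^sub>F n in sequentially. a n < 1"
    using a0 by (rule order_tendstoD) simp
  have ev1: "\<forall>\<^sub>F n in sequentially. (1 - a n) ^ k n = exp (- y n)"
    using ev by eventually_elim (simp add: y_def exp_of_nat_mult)
  have ev2: "\<forall>\<^sub>F n in sequentially. real (k n) * a n \<le> y n"
    using ev
  proof eventually_elim
    case (elim n)
    have "ln (1 - a n) \<le> - a n" using ln_le_minus_one[of "1 - a n"] elim by simp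
    then have "real (k n) * ln (1 - a n) \<le> real (k n) * (- a n)" by (intro mult_left_mono) auto
    then show ?case by (simp add: y_def)
  qed
  have ev3: "\<forall>\<^sub>F n in sequentially. y n * (1 - a n) \<le> real (k n) * a n"
    using ev
  proof eventually_elim
    case (elim n)
    have "ln (1 / (1 - a n)) \<le> 1 / (1 - a n) - 1" using elim by (intro ln_le_minus_one) simp
    then have "- ln (1 - a n) \<le> a n / (1 - a n)" using elim by (simp add: ln_div field_simps)
    then have "- ln (1 - a n) * (1 - a n) \<le> a n" using elim by (simp add: field_simps)
    then have "real (k n) * (- ln (1 - a n) * (1 - a n)) \<le> real (k n) * a n"
      by (intro mult_left_mono) auto
    then show ?case by (simp add: y_def algebra_simps)
  qed
  have "(\<lambda>n. (1 - a n) ^ k n) \<longlonglongrightarrow> exp (- s) \<longleftrightarrow> (\<lambda>n. exp (- y n)) \<longlonglongrightarrow> exp (- s)"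
    by (rule tendsto_cong[OF ev1])
  also have "\<dots> \<longleftrightarrow> y \<longlonglongrightarrow> s"
  proof
    assume "(\<lambda>n. exp (- y n)) \<longlonglongrightarrow> exp (- s)"
    then have "(\<lambda>n. - ln (exp (- y n))) \<longlonglongrightarrow> - ln (exp (- s))"
      by (intro tendsto_minus tendsto_ln) auto
    then show "y \<longlonglongrightarrow> s" by (simp only: ln_exp minus_minus)
  next
    assume "y \<longlonglongrightarrow> s"
    then show "(\<lambda>n. exp (- y n)) \<longlonglongrightarrow> exp (- s)" by (intro tendsto_intros)
  qed
  also have "\<dots> \<longleftrightarrow> (\<lambda>n. real (k n) * a n) \<longlonglongrightarrow> s"
  proof
    assume y: "y \<longlonglongrightarrow> s"
    have "(\<lambda>n. y n * (1 - a n)) \<longlonglongrightarrow> s * (1 - 0)"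
      by (intro tendsto_intros y a0)
    then have "(\<lambda>n. y n * (1 - a n)) \<longlonglongrightarrow> s" by simp
    from tendsto_sandwich[OF ev3 ev2 this y] show "(\<lambda>n. real (k n) * a n) \<longlonglongrightarrow> s" .
  next
    assume ka: "(\<lambda>n. real (k n) * a n) \<longlonglongrightarrow> s"
    have "(\<lambda>n. real (k n) * a n / (1 - a n)) \<longlonglongrightarrow> s / (1 - 0)"
      by (intro tendsto_intros ka a0) auto
    then have lim: "(\<lambda>n. real (k n) * a n / (1 - a n)) \<longlonglongrightarrow> s" by simp
    have "\<forall>\<^sub>F n in sequentially. y n \<le> real (k n) * a n / (1 - a n)"
      using ev ev3 by eventually_elim (simp add: pos_le_divide_eq)
    from tendsto_sandwich[OF ev2 this ka lim] show "y \<longlonglongrightarrow> s" .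
  qed
  finally show ?thesis .
qed

lemma ball_shift: "(\<forall>m\<in>{a + i..a + j}. R m) \<longleftrightarrow> (\<forall>m\<in>{i..j}. R (a + m))" for a i j :: nat
proof -
  have eq: "{a + i..a + j} = (+) a ` {i..j}" by (simp add: add.commute)
  show ?thesis unfolding eq by blast
qed

section \<open>Union bounds, disjoint sums and the mixing coefficient\<close>

context prob_space
begin

text \<open>The difference belongs to the set whose supremum is the mixing coefficient. A real
  supremum bounds the members only of sets bounded above; here 1 is a bound.\<close>

lemma mixing_coeff_ge:
  assumes "1 \<le> i" "i < i + a + l" "i + a + l \<le> j" "j < j + b" "j + b \<le> n"
  shows "\<bar>\<P>(\<omega> in M. (\<forall>m\<in>{i..i + a}. W m \<omega> \<le> u n) \<and> (\<forall>m\<in>{j..j + b}. W m \<omega> \<le> u n))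
           - \<P>(\<omega> in M. \<forall>m\<in>{i..i + a}. W m \<omega> \<le> u n) * \<P>(\<omega> in M. \<forall>m\<in>{j..j + b}. W m \<omega> \<le> u n)\<bar>
         \<le> mixing_coeff M W u n l"
  unfolding mixing_coeff_def seq_max_le_iff
proof (rule cSup_upper)
  have diff_le: "\<bar>x - y * z\<bar> \<le> 1" if "0 \<le> x" "x \<le> 1" "0 \<le> y" "y \<le> 1" "0 \<le> z" "z \<le> 1" for x y z :: real
  proof -
    have "0 \<le> y * z" "y * z \<le> 1" using that by (auto intro: mult_le_one)
    with that show ?thesis by linarith
  qed
  show "bdd_above {\<bar>\<P>(\<omega> in M. (\<forall>m\<in>{i..i + a}. W m \<omega> \<le> u n) \<and> (\<forall>m\<in>{j..j + b}. W m \<omega> \<le> u n))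
           - \<P>(\<omega> in M. \<forall>m\<in>{i..i + a}. W m \<omega> \<le> u n) * \<P>(\<omega> in M. \<forall>m\<in>{j..j + b}. W m \<omega> \<le> u n)\<bar>
         | i a j b. 1 \<le> i \<and> i < i + a + l \<and> i + a + l \<le> j \<and> j < j + b \<and> j + b \<le> n}"
    by (rule bdd_aboveI[of _ 1]) (auto intro!: diff_le)
qed (use assms in blast)

lemma prob_Ex_le_sum:
  assumes "finite I" "\<And>i. i \<in> I \<Longrightarrow> Measurable.pred M (P i)"
    and "\<And>\<omega>. \<omega> \<in> space M \<Longrightarrow> Q \<omega> \<Longrightarrow> \<exists>i\<in>I. P i \<omega>"
  shows "\<P>(\<omega> in M. Q \<omega>) \<le> (\<Sum>i\<in>I. \<P>(\<omega> in M. P i \<omega>))"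
proof -
  have [measurable]: "{\<omega>\<in>space M. P i \<omega>} \<in> sets M" if "i \<in> I" for i
    using assms(2)[OF that] by measurable
  have "\<P>(\<omega> in M. Q \<omega>) \<le> prob (\<Union>i\<in>I. {\<omega>\<in>space M. P i \<omega>})"
    using assms by (intro finite_measure_mono) auto
  also have "\<dots> \<le> (\<Sum>i\<in>I. \<P>(\<omega> in M. P i \<omega>))"
    using assms by (intro finite_measure_subadditive_finite) auto
  finally show ?thesis .
qed

lemma sum_disjoint_le_prob:
  assumes "finite I" "\<And>i. i \<in> I \<Longrightarrow> Measurable.pred M (P i)" "Measurable.pred M Q"
    and "\<And>i \<omega>. i \<in> I \<Longrightarrow> \<omega> \<in> space M \<Longrightarrow> P i \<omega> \<Longrightarrow> Q \<omega>"
    and "\<And>i j \<omega>. i \<in> I \<Longrightarrow> j \<in> I \<Longrightarrow> \<omega> \<in> space M \<Longrightarrow> P i \<omega> \<Longrightarrow> P j \<omega> \<Longrightarrow> i = j"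
  shows "(\<Sum>i\<in>I. \<P>(\<omega> in M. P i \<omega>)) \<le> \<P>(\<omega> in M. Q \<omega>)"
proof -
  have [measurable]: "{\<omega>\<in>space M. P i \<omega>} \<in> sets M" if "i \<in> I" for i
    using assms(2)[OF that] by measurable
  have "(\<Sum>i\<in>I. \<P>(\<omega> in M. P i \<omega>)) = prob (\<Union>i\<in>I. {\<omega>\<in>space M. P i \<omega>})"
    using assms by (intro finite_measure_finite_Union[symmetric])
      (auto simp: disjoint_family_on_def)
  also have "\<dots> \<le> \<P>(\<omega> in M. Q \<omega>)"
    using assms by (intro finite_measure_mono) auto
  finally show ?thesis .
qed

lemma prob_conj_not:
  assumes [measurable]: "Measurable.pred M P" "Measurable.pred M Q"
  shows "\<P>(\<omega> in M. P \<omega>) = \<P>(\<omega> in M. P \<omega> \<and> Q \<omega>) + \<P>(\<omega> in M. P \<omega> \<and> \<not> Q \<omega>)"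
  by (subst finite_measure_Union[symmetric]) (auto intro!: arg_cong[where f = prob])

end

text \<open>Only finite exceedance patterns enter, so \<open>periodic\<close> quantifies over
  predicates \<open>Q\<close> of a pattern instead of speaking of joint laws. Index 0 is excluded
  because \<open>Y\<close> is meant from index 1 on, and \<open>n\<close> starts at 1 because the
  levels are only known to be positive there. The constant \<open>c\<close> turns a count of indices
  into a probability: one of \<open>m\<close> given indices is exceeded with probability at most
  \<open>m c / n\<close>.\<close>

locale blocks = prob_space M for M :: "'w measure" +
  fixes W :: "nat \<Rightarrow> 'w \<Rightarrow> real" and T :: nat and u :: "nat \<Rightarrow> real" and l k :: "nat \<Rightarrow> nat" and c :: real
  assumes W_meas[measurable]: "\<And>j. W j \<in> borel_measurable M"
    and T_pos: "0 < T"
    and periodic: "\<And>n q J Q. 1 \<le> n \<Longrightarrow> finite J \<Longrightarrow> 0 \<notin> J \<Longrightarrow>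
      \<P>(\<omega> in M. Q {j \<in> J. W (q * T + j) \<omega> > u n}) = \<P>(\<omega> in M. Q {j \<in> J. W j \<omega> > u n})"
    and exceed_bound: "\<And>n j. 1 \<le> n \<Longrightarrow> 1 \<le> j \<Longrightarrow> real n * \<P>(\<omega> in M. W j \<omega> > u n) \<le> c"
    and k_pos: "\<And>n. 0 < k n"
    and k_inf: "filterlim k at_top sequentially"
    and k_small: "(\<lambda>n. real (k n) / real n) \<longlonglongrightarrow> 0"
    and kl_small: "(\<lambda>n. real (k n) * real (l n) / real n) \<longlonglongrightarrow> 0"
    and k_mix: "(\<lambda>n. real (k n) * mixing_coeff M W u n (l n)) \<longlonglongrightarrow> 0"
begin

text \<open>A multiple of \<open>T\<close>, so that every block is a shift of the first one to which
  \<open>periodic\<close> applies; it is also the length that occurs in the local condition.\<close>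

definition blk :: "nat \<Rightarrow> nat" where "blk n = n div (k n * T) * T"

definition hit :: "nat \<Rightarrow> real" where
  "hit n = \<P>(\<omega> in M. \<exists>j\<in>{1..blk n}. W j \<omega> > u n)"

definition run_end :: "nat \<Rightarrow> nat \<Rightarrow> real" where
  "run_end n j = \<P>(\<omega> in M. W j \<omega> > u n \<and> (\<forall>i\<in>{j + 1..j + T}. W i \<omega> \<le> u n))"

lemma k_blk_le: "k n * blk n \<le> n"
proof -
  have "k n * blk n = n div (k n * T) * (k n * T)" by (simp add: blk_def algebra_simps)
  also have "\<dots> \<le> n" by simp
  finally show ?thesis .
qed

text \<open>At most \<open>k n * T\<close> indices lie outside the blocks, a negligible part of
  \<open>n\<close> by \<open>k_small\<close>.\<close>

lemma le_k_blk: "n \<le> k n * blk n + k n * T"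
proof -
  have "k n * T > 0" using k_pos T_pos by simp
  then have "n < n div (k n * T) * (k n * T) + k n * T"
    by (metis div_mult_mod_eq mod_less_divisor nat_add_left_cancel_less)
  also have "\<dots> = k n * blk n + k n * T" by (simp add: blk_def algebra_simps)
  finally show ?thesis by simp
qed

lemma c_nonneg: "0 \<le> c"
  by (rule order_trans[OF _ exceed_bound[of 1 1]]) auto

lemma prob_exceed_le:
  assumes "1 \<le> n" "finite J" "0 \<notin> J"
  shows "\<P>(\<omega> in M. \<exists>j\<in>J. W j \<omega> > u n) \<le> real (card J) * c / real n"
proof -
  have "\<P>(\<omega> in M. \<exists>j\<in>J. W j \<omega> > u n) \<le> (\<Sum>j\<in>J. \<P>(\<omega> in M. W j \<omega> > u n))"
    using assms by (intro prob_Ex_le_sum) auto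
  also have "\<dots> \<le> (\<Sum>j\<in>J. c / real n)"
  proof (rule sum_mono)
    fix j assume "j \<in> J"
    with assms have "1 \<le> j" by (cases j) auto
    from exceed_bound[OF assms(1) this] assms(1)
    show "\<P>(\<omega> in M. W j \<omega> > u n) \<le> c / real n" by (simp add: field_simps)
  qed
  finally show ?thesis by simp
qed

lemma hit_nonneg: "0 \<le> hit n"
  by (simp add: hit_def)

lemma hit_tendsto_0: "hit \<longlonglongrightarrow> 0"
proof (rule tendsto_sandwich)
  show "\<forall>\<^sub>F n in sequentially. 0 \<le> hit n" by (simp add: hit_nonneg)
  show "\<forall>\<^sub>F n in sequentially. hit n \<le> c / real (k n)"
    using eventually_ge_at_top[of 1]
  proof eventually_elim
    case (elim n)
    have "hit n \<le> real (blk n) * c / real n"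
      using prob_exceed_le[OF elim, of "{1..blk n}"] by (simp add: hit_def)
    also have "\<dots> \<le> c / real (k n)"
    proof -
      have "real (k n) * real (blk n) \<le> real n" using k_blk_le[of n] by (metis of_nat_le_iff of_nat_mult)
      then have "c * (real (k n) * real (blk n)) \<le> c * real n" using c_nonneg by (rule mult_left_mono)
      then show ?thesis using elim k_pos[of n] by (simp add: field_simps)
    qed
    finally show ?case .
  qed
  show "(\<lambda>n. c / real (k n)) \<longlonglongrightarrow> 0"
    by (intro tendsto_divide_0[OF tendsto_const]
      filterlim_at_top_imp_at_infinity filterlim_compose[OF filterlim_real_sequentially k_inf])
qed simp

lemma run_end_periodic:
  assumes "1 \<le> n" "1 \<le> i"
  shows "run_end n (q * T + i) = run_end n i"
proof -
  let ?Q = "\<lambda>E. i \<in> E \<and> (\<forall>m\<in>{i + 1..i + T}. m \<notin> E)"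
  have "run_end n (q * T + i) = \<P>(\<omega> in M. ?Q {j \<in> {i..i + T}. W (q * T + j) \<omega> > u n})"
    unfolding run_end_def
    unfolding add.assoc ball_shift
    by (intro arg_cong[where f = prob] Collect_cong) (auto simp: not_less)
  also have "\<dots> = \<P>(\<omega> in M. ?Q {j \<in> {i..i + T}. W j \<omega> > u n})"
    using assms by (intro periodic) auto
  also have "\<dots> = run_end n i"
    unfolding run_end_def by (intro arg_cong[where f = prob] Collect_cong) (auto simp: not_less)
  finally show ?thesis .
qed

lemma block_periodic:
  assumes "1 \<le> n"
  shows "\<P>(\<omega> in M. \<forall>j\<in>{q * T + 1..q * T + s}. W j \<omega> \<le> u n) = \<P>(\<omega> in M. \<forall>j\<in>{1..s}. W j \<omega> \<le> u n)"
proof -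
  have "\<P>(\<omega> in M. \<forall>j\<in>{q * T + 1..q * T + s}. W j \<omega> \<le> u n) =
    \<P>(\<omega> in M. {j \<in> {1..s}. W (q * T + j) \<omega> > u n} = {})"
    unfolding ball_shift by (intro arg_cong[where f = prob] Collect_cong) (auto simp: not_less)
  also have "\<dots> = \<P>(\<omega> in M. {j \<in> {1..s}. W j \<omega> > u n} = {})"
    using assms by (intro periodic) auto
  also have "\<dots> = \<P>(\<omega> in M. \<forall>j\<in>{1..s}. W j \<omega> \<le> u n)"
    by (intro arg_cong[where f = prob] Collect_cong) (auto simp: not_less)
  finally show ?thesis .
qed

section \<open>Asymptotic independence of the block maxima\<close>

lemma one_minus_hit: "1 - hit n = \<P>(\<omega> in M. \<forall>j\<in>{1..blk n}. W j \<omega> \<le> u n)"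
proof -
  have "\<P>(\<omega> in M. \<forall>j\<in>{1..blk n}. W j \<omega> \<le> u n) = prob (space M - {\<omega>\<in>space M. \<exists>j\<in>{1..blk n}. W j \<omega> > u n})"
    by (intro arg_cong[where f = prob]) (auto simp: not_less)
  then show ?thesis by (simp add: hit_def prob_compl)
qed

text \<open>The two events differ only if an index of \<open>A - B\<close> is exceeded, so the union
  bound applies. This prices the gaps cut out between blocks and the remainder after the last
  block.\<close>

lemma prob_le_subset:
  assumes n: "1 \<le> n" and "finite A" "0 \<notin> A" "B \<subseteq> A"
  shows "\<bar>\<P>(\<omega> in M. \<forall>j\<in>A. W j \<omega> \<le> u n) - \<P>(\<omega> in M. \<forall>j\<in>B. W j \<omega> \<le> u n)\<bar> \<le> real (card (A - B)) * c / real n"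
proof -
  have fB: "finite B" using assms finite_subset by auto
  have "\<P>(\<omega> in M. \<forall>j\<in>B. W j \<omega> \<le> u n)
     = \<P>(\<omega> in M. (\<forall>j\<in>B. W j \<omega> \<le> u n) \<and> (\<forall>j\<in>A. W j \<omega> \<le> u n)) +
       \<P>(\<omega> in M. (\<forall>j\<in>B. W j \<omega> \<le> u n) \<and> \<not> (\<forall>j\<in>A. W j \<omega> \<le> u n))"
    using assms fB by (intro prob_conj_not) auto
  moreover have "\<P>(\<omega> in M. (\<forall>j\<in>B. W j \<omega> \<le> u n) \<and> (\<forall>j\<in>A. W j \<omega> \<le> u n)) = \<P>(\<omega> in M. \<forall>j\<in>A. W j \<omega> \<le> u n)"
    using assms by (intro arg_cong[where f = prob] Collect_cong) auto
  moreover have "\<P>(\<omega> in M. (\<forall>j\<in>B. W j \<omega> \<le> u n) \<and> \<not> (\<forall>j\<in>A. W j \<omega> \<le> u n)) \<le>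
     \<P>(\<omega> in M. \<exists>j\<in>A - B. W j \<omega> > u n)"
    using assms by (intro finite_measure_mono) (auto simp: not_le, meson DiffI not_le)
  moreover have "\<dots> \<le> real (card (A - B)) * c / real n"
    using assms by (intro prob_exceed_le) auto
  moreover have "0 \<le> \<P>(\<omega> in M. (\<forall>j\<in>B. W j \<omega> \<le> u n) \<and> \<not> (\<forall>j\<in>A. W j \<omega> \<le> u n))" by simp
  ultimately show ?thesis by linarith
qed

text \<open>The first \<open>l n\<close> indices of the new block are deleted to make room for the
  mixing bound and restored afterwards. Each of the two changes costs \<open>l n * c / n\<close>,
  whence the factor 2.\<close>

lemma block_step:
  assumes n: "1 \<le> n" and r: "l n + 2 \<le> blk n" and m: "1 \<le> m" "(m + 1) * blk n \<le> n"
  shows "\<bar>\<P>(\<omega> in M. \<forall>j\<in>{1..(m + 1) * blk n}. W j \<omega> \<le> u n) -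
     \<P>(\<omega> in M. \<forall>j\<in>{1..m * blk n}. W j \<omega> \<le> u n) * (1 - hit n)\<bar>
    \<le> 2 * (real (l n) * c / real n) + mixing_coeff M W u n (l n)"
proof -
  let ?r = "blk n" and ?l = "l n"
  let ?le = "\<lambda>A. \<P>(\<omega> in M. \<forall>j\<in>A. W j \<omega> \<le> u n)"
  let ?A = "{1..m * ?r}" and ?B = "{m * ?r + 1..m * ?r + ?r}" and ?B' = "{m * ?r + ?l + 1..m * ?r + ?r}"
  \<comment> \<open>The new block starts right after a multiple of \<open>T\<close>, hence has the
    law of the first block.\<close>
  obtain q where q: "m * ?r = q * T" by (metis blk_def mult.assoc)
  have mr: "?r \<le> m * ?r" using m by simp
  have B: "?le ?B = 1 - hit n"
    unfolding one_minus_hit q by (rule block_periodic[OF n])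
  have "\<bar>?le {1..(m + 1) * ?r} - ?le (?A \<union> ?B')\<bar> \<le> real (card ({1..(m + 1) * ?r} - (?A \<union> ?B'))) * c / real n"
    by (rule prob_le_subset[OF n]) auto
  also have "{1..(m + 1) * ?r} - (?A \<union> ?B') = {m * ?r + 1..m * ?r + ?l}"
    using r by (auto simp: algebra_simps)
  finally have 1: "\<bar>?le {1..(m + 1) * ?r} - ?le (?A \<union> ?B')\<bar> \<le> real ?l * c / real n" by simp
  have "\<bar>?le ?B - ?le ?B'\<bar> \<le> real (card (?B - ?B')) * c / real n"
    by (rule prob_le_subset[OF n]) auto
  also have "?B - ?B' = {m * ?r + 1..m * ?r + ?l}" using r by auto
  finally have 2: "\<bar>?le ?B - ?le ?B'\<bar> \<le> real ?l * c / real n" by simp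
  \<comment> \<open>The mixing coefficient describes an interval by its first index and its length
    minus one. The second increment \<open>blk n - l n - 1\<close> has to be at least 1, which is
    the reason for requiring \<open>l n + 2 \<le> blk n\<close>.\<close>
  have A_eq: "{1..1 + (m * ?r - 1)} = ?A" using mr r by auto
  have B_eq: "{m * ?r + ?l + 1..m * ?r + ?l + 1 + (?r - ?l - 1)} = ?B'" using r by auto
  have "?le (?A \<union> ?B') = \<P>(\<omega> in M. (\<forall>j\<in>?A. W j \<omega> \<le> u n) \<and> (\<forall>j\<in>?B'. W j \<omega> \<le> u n))"
    by (intro arg_cong[where f = prob] Collect_cong) auto
  then have 3: "\<bar>?le (?A \<union> ?B') - ?le ?A * ?le ?B'\<bar> \<le> mixing_coeff M W u n ?l"
    using mixing_coeff_ge[of 1 "m * ?r - 1" ?l "m * ?r + ?l + 1" "?r - ?l - 1" n W u] r mr m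
    unfolding A_eq B_eq by (simp add: algebra_simps)
  have "\<bar>?le ?A * ?le ?B' - ?le ?A * ?le ?B\<bar> = ?le ?A * \<bar>?le ?B - ?le ?B'\<bar>"
    by (simp add: abs_mult abs_minus_commute flip: right_diff_distrib)
  also have "\<dots> \<le> 1 * \<bar>?le ?B - ?le ?B'\<bar>" by (intro mult_right_mono) auto
  also have "\<dots> \<le> real ?l * c / real n" using 2 by simp
  finally have 4: "\<bar>?le ?A * ?le ?B' - ?le ?A * ?le ?B\<bar> \<le> real ?l * c / real n" .
  show ?thesis using 1 3 4 unfolding B by linarith
qed

text \<open>In each step the previous error is multiplied by \<open>1 - hit n\<close>, which lies
  between 0 and 1, so errors only add up. The absolute value keeps the bound nonnegative without
  knowing the sign of the mixing coefficient.\<close>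

lemma block_power:
  assumes n: "1 \<le> n" and r: "l n + 2 \<le> blk n" and m: "1 \<le> m" "m * blk n \<le> n"
  shows "\<bar>\<P>(\<omega> in M. \<forall>j\<in>{1..m * blk n}. W j \<omega> \<le> u n) - (1 - hit n) ^ m\<bar>
    \<le> real m * (2 * (real (l n) * c / real n) + \<bar>mixing_coeff M W u n (l n)\<bar>)"
  using m
proof (induction m rule: dec_induct)
  case base
  then show ?case using c_nonneg by (simp add: one_minus_hit)
next
  case (step m)
  let ?x = "\<lambda>m. \<P>(\<omega> in M. \<forall>j\<in>{1..m * blk n}. W j \<omega> \<le> u n)"
  let ?d = "2 * (real (l n) * c / real n) + \<bar>mixing_coeff M W u n (l n)\<bar>"
  have hit: "0 \<le> 1 - hit n" "1 - hit n \<le> 1" unfolding one_minus_hit by simp_all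
  have 1: "\<bar>?x (Suc m) - ?x m * (1 - hit n)\<bar> \<le> ?d"
    using block_step[OF n r, of m] step by simp
  have "\<bar>?x m * (1 - hit n) - (1 - hit n) ^ m * (1 - hit n)\<bar> = \<bar>?x m - (1 - hit n) ^ m\<bar> * (1 - hit n)"
    using hit by (simp add: abs_mult flip: left_diff_distrib)
  also have "\<dots> \<le> \<bar>?x m - (1 - hit n) ^ m\<bar> * 1" using hit by (intro mult_left_mono) auto
  also have "\<dots> \<le> real m * ?d" using step by simp
  finally have 2: "\<bar>?x m * (1 - hit n) - (1 - hit n) ^ m * (1 - hit n)\<bar> \<le> real m * ?d" .
  have "\<bar>?x (Suc m) - (1 - hit n) ^ m * (1 - hit n)\<bar> \<le> ?d + real m * ?d"
    using 1 2 by linarith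
  also have "\<dots> = real (Suc m) * ?d" by (simp add: algebra_simps add_divide_distrib)
  finally show ?case by (simp only: power_Suc2)
qed

text \<open>The product \<open>k n * (l n + 2 + T)\<close> is eventually below \<open>n\<close>,
  whereas \<open>n \<le> k n * (blk n + T)\<close>; it remains to cancel \<open>k n\<close>.\<close>

lemma blk_large: "\<forall>\<^sub>F n in sequentially. l n + 2 \<le> blk n"
proof -
  have "(\<lambda>n. real (k n) * real (l n) / real n + (2 + real T) * (real (k n) / real n)) \<longlonglongrightarrow> 0 + (2 + real T) * 0"
    by (intro tendsto_intros kl_small k_small)
  then have "\<forall>\<^sub>F n in sequentially. real (k n) * real (l n) / real n + (2 + real T) * (real (k n) / real n) < 1"
    by (rule order_tendstoD) simp
  then show ?thesis using eventually_ge_at_top[of 1]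
  proof eventually_elim
    case (elim n)
    then have "real (k n) * real (l n) + (2 + real T) * real (k n) < real n"
      by (simp add: field_simps)
    then have "real (k n * (l n + 2 + T)) < real n" by (simp add: algebra_simps)
    then have "k n * (l n + 2 + T) < n" by (simp only: of_nat_less_iff)
    also have "n \<le> k n * (blk n + T)" using le_k_blk[of n] by (simp add: algebra_simps)
    finally have "l n + 2 + T < blk n + T" by (simp only: mult_less_cancel1)
    then show ?case by simp
  qed
qed

lemma prob_max_minus_block_power:
  "(\<lambda>n. \<P>(\<omega> in M. \<forall>j\<in>{1..n}. W j \<omega> \<le> u n) - (1 - hit n) ^ k n) \<longlonglongrightarrow> 0"
proof (rule Lim_null_comparison)
  \<comment> \<open>The three terms pay for the remainder after the last block, for the gaps between
    blocks and for the mixing errors.\<close>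
  let ?b = "\<lambda>n. real T * c * (real (k n) / real n) + (2 * c * (real (k n) * real (l n) / real n)
    + \<bar>real (k n) * mixing_coeff M W u n (l n)\<bar>)"
  show "\<forall>\<^sub>F n in sequentially.
     norm (\<P>(\<omega> in M. \<forall>j\<in>{1..n}. W j \<omega> \<le> u n) - (1 - hit n) ^ k n) \<le> ?b n"
    using blk_large eventually_ge_at_top[of 1]
  proof eventually_elim
    case (elim n)
    let ?le = "\<lambda>A. \<P>(\<omega> in M. \<forall>j\<in>A. W j \<omega> \<le> u n)"
    have "\<bar>?le {1..n} - ?le {1..k n * blk n}\<bar> \<le> real (card ({1..n} - {1..k n * blk n})) * c / real n"
      using k_blk_le[of n] elim(2) by (intro prob_le_subset) auto
    also have "{1..n} - {1..k n * blk n} = {k n * blk n + 1..n}" by auto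
    also have "real (card \<dots>) \<le> real (k n * T)" using le_k_blk[of n] by (simp only: of_nat_le_iff card_atLeastAtMost)
    finally have 1: "\<bar>?le {1..n} - ?le {1..k n * blk n}\<bar> \<le> real T * c * (real (k n) / real n)"
      using c_nonneg by (simp add: algebra_simps divide_right_mono mult_right_mono)
    have 2: "\<bar>?le {1..k n * blk n} - (1 - hit n) ^ k n\<bar>
      \<le> real (k n) * (2 * (real (l n) * c / real n) + \<bar>mixing_coeff M W u n (l n)\<bar>)"
      using k_pos[of n] k_blk_le[of n] elim by (intro block_power) auto
    also have "\<dots> = 2 * c * (real (k n) * real (l n) / real n) + \<bar>real (k n) * mixing_coeff M W u n (l n)\<bar>"
      by (simp add: algebra_simps abs_mult)
    finally show ?case using 1 by simp
  qed
  have "?b \<longlonglongrightarrow> real T * c * 0 + (2 * c * 0 + \<bar>0\<bar>)"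
    by (intro tendsto_intros kl_small k_small k_mix)
  then show "?b \<longlonglongrightarrow> 0" by simp
qed

lemma prob_max_tendsto_iff:
  "(\<lambda>n. \<P>(\<omega> in M. \<forall>j\<in>{1..n}. W j \<omega> \<le> u n)) \<longlonglongrightarrow> exp (- s) \<longleftrightarrow>
   (\<lambda>n. real (k n) * hit n) \<longlonglongrightarrow> s"
proof -
  have "(\<lambda>n. \<P>(\<omega> in M. \<forall>j\<in>{1..n}. W j \<omega> \<le> u n)) \<longlonglongrightarrow> exp (- s) \<longleftrightarrow>
    (\<lambda>n. (1 - hit n) ^ k n) \<longlonglongrightarrow> exp (- s)"
    using prob_max_minus_block_power by (rule Lim_transform_eq)
  then show ?thesis using power_near_exp_iff[OF hit_tendsto_0 hit_nonneg] by simp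
qed

section \<open>Counting exceeded blocks by their run ends\<close>

lemma sum_run_end:
  assumes "1 \<le> n"
  shows "(\<Sum>j=1..blk n. run_end n j) = real (blk n) / real T * (\<Sum>i=1..T. run_end n i)"
proof -
  have "(\<Sum>j=1..m * T. run_end n j) = real m * (\<Sum>i=1..T. run_end n i)" for m
  proof (induction m)
    case (Suc m)
    have "{1..Suc m * T} = {1..m * T} \<union> {m * T + 1..m * T + T}" by auto
    then have "(\<Sum>j=1..Suc m * T. run_end n j) = (\<Sum>j=1..m * T. run_end n j) + (\<Sum>j=m * T + 1..m * T + T. run_end n j)"
      by (simp only:, intro sum.union_disjoint) auto
    also have "(\<Sum>j=m * T + 1..m * T + T. run_end n j) = (\<Sum>i=1..T. run_end n (m * T + i))"
      by (rule sum.reindex_bij_witness[of _ "\<lambda>i. m * T + i" "\<lambda>j. j - m * T"]) auto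
    also have "\<dots> = (\<Sum>i=1..T. run_end n i)"
      using assms by (intro sum.cong refl run_end_periodic) auto
    finally show ?case using Suc by (simp add: algebra_simps)
  qed simp
  from this[of "n div (k n * T)"] show ?thesis using T_pos by (simp add: blk_def)
qed

text \<open>The last exceedance of a block is a run end unless it lies among the last
  \<open>T\<close> indices, which gives the term \<open>T c / n\<close>. Conversely, a run end with
  no later exceedance in the block is the last exceedance, so these events are disjoint; the run
  ends followed by a return cost at most \<open>e\<close> each.\<close>

lemma hit_minus_run_ends:
  assumes "1 \<le> n" and err: "\<And>j. 1 \<le> j \<Longrightarrow> j \<le> blk n \<Longrightarrow>
    \<P>(\<omega> in M. W j \<omega> > u n \<and> (\<forall>i\<in>{j + 1..j + T}. W i \<omega> \<le> u n) \<and> (\<exists>i\<in>{j + T + 1..blk n}. W i \<omega> > u n)) \<le> e"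
  shows "\<bar>hit n - (\<Sum>j=1..blk n. run_end n j)\<bar> \<le> real T * c / real n + real (blk n) * e"
proof -
  let ?r = "blk n" and ?ex = "\<lambda>j \<omega>. W j \<omega> > u n"
  let ?f = "\<lambda>j \<omega>. ?ex j \<omega> \<and> (\<forall>i\<in>{j + 1..j + T}. W i \<omega> \<le> u n)"
  let ?g = "\<lambda>j \<omega>. \<exists>i\<in>{j + T + 1..?r}. W i \<omega> > u n"
  \<comment> \<open>The disjoint sum \<open><+>\<close> lets one union bound range over two
    families: run ends on the left, plain exceedances near the end of the block on the
    right.\<close>
  have "hit n \<le> (\<Sum>j\<in>{1..?r} <+> {?r - T + 1..?r}. \<P>(\<omega> in M. case_sum ?f ?ex j \<omega>))"
    unfolding hit_def
  proof (rule prob_Ex_le_sum)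
    fix j assume "j \<in> {1..?r} <+> {?r - T + 1..?r}"
    then show "Measurable.pred M (case_sum ?f ?ex j)" by (cases j) auto
  next
    fix \<omega> assume "\<exists>j\<in>{1..?r}. ?ex j \<omega>"
    define m where "m = Max {j\<in>{1..?r}. ?ex j \<omega>}"
    have "m \<in> {j\<in>{1..?r}. ?ex j \<omega>}"
      unfolding m_def using \<open>\<exists>j\<in>{1..?r}. ?ex j \<omega>\<close> by (intro Max_in) auto
    then have m: "1 \<le> m" "m \<le> ?r" "?ex m \<omega>" by auto
    have later: "W i \<omega> \<le> u n" if "m < i" "i \<le> ?r" for i
    proof (rule ccontr)
      assume "\<not> W i \<omega> \<le> u n"
      then have "i \<le> m" unfolding m_def using that by (intro Max_ge) auto
      with that show False by simp
    qed
    show "\<exists>j\<in>{1..?r} <+> {?r - T + 1..?r}. case_sum ?f ?ex j \<omega>"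
    proof (cases "m + T \<le> ?r")
      case True
      then show ?thesis using m later by (intro bexI[of _ "Inl m"]) auto
    next
      case False
      then show ?thesis using m by (intro bexI[of _ "Inr m"]) auto
    qed
  qed auto
  also have "\<dots> = (\<Sum>j=1..?r. run_end n j) + (\<Sum>j\<in>{?r - T + 1..?r}. \<P>(\<omega> in M. ?ex j \<omega>))"
    by (simp add: sum.Plus run_end_def)
  also have "(\<Sum>j\<in>{?r - T + 1..?r}. \<P>(\<omega> in M. ?ex j \<omega>)) \<le> (\<Sum>j\<in>{?r - T + 1..?r}. c / real n)"
    using exceed_bound[OF assms(1)] assms(1) by (intro sum_mono) (auto simp: field_simps)
  also have "\<dots> \<le> real T * (c / real n)"
    using c_nonneg by (simp only: sum_constant card_atLeastAtMost) (intro mult_right_mono, auto)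
  finally have upper: "hit n \<le> (\<Sum>j=1..?r. run_end n j) + real T * c / real n" by simp
  have "run_end n j \<le> \<P>(\<omega> in M. ?ex j \<omega> \<and> (\<forall>i\<in>{j + 1..?r}. W i \<omega> \<le> u n)) + e"
    if "1 \<le> j" "j \<le> ?r" for j
  proof -
    have "run_end n j = \<P>(\<omega> in M. ?f j \<omega> \<and> ?g j \<omega>) + \<P>(\<omega> in M. ?f j \<omega> \<and> \<not> ?g j \<omega>)"
      unfolding run_end_def by (rule prob_conj_not) auto
    also have "\<P>(\<omega> in M. ?f j \<omega> \<and> ?g j \<omega>) \<le> e"
      using err[OF that] by (simp add: conj_assoc)
    also have "\<P>(\<omega> in M. ?f j \<omega> \<and> \<not> ?g j \<omega>) \<le> \<P>(\<omega> in M. ?ex j \<omega> \<and> (\<forall>i\<in>{j + 1..?r}. W i \<omega> \<le> u n))"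
    proof (intro finite_measure_mono subsetI)
      fix \<omega> assume *: "\<omega> \<in> {\<omega>\<in>space M. ?f j \<omega> \<and> \<not> ?g j \<omega>}"
      have "W i \<omega> \<le> u n" if "i \<in> {j + 1..?r}" for i
        using * that by (cases "i \<le> j + T") (auto simp: not_less)
      with * show "\<omega> \<in> {\<omega>\<in>space M. ?ex j \<omega> \<and> (\<forall>i\<in>{j + 1..?r}. W i \<omega> \<le> u n)}" by auto
    qed simp
    finally show ?thesis by simp
  qed
  then have "(\<Sum>j=1..?r. run_end n j) \<le> (\<Sum>j=1..?r. \<P>(\<omega> in M. ?ex j \<omega> \<and> (\<forall>i\<in>{j + 1..?r}. W i \<omega> \<le> u n)) + e)"
    by (intro sum_mono) auto
  also have "\<dots> = (\<Sum>j=1..?r. \<P>(\<omega> in M. ?ex j \<omega> \<and> (\<forall>i\<in>{j + 1..?r}. W i \<omega> \<le> u n))) + real ?r * e"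
    by (simp add: sum.distrib)
  also have "(\<Sum>j=1..?r. \<P>(\<omega> in M. ?ex j \<omega> \<and> (\<forall>i\<in>{j + 1..?r}. W i \<omega> \<le> u n))) \<le> hit n"
    unfolding hit_def
  proof (rule sum_disjoint_le_prob)
    fix i j \<omega>
    assume *: "i \<in> {1..?r}" "j \<in> {1..?r}" "?ex i \<omega> \<and> (\<forall>m\<in>{i + 1..?r}. W m \<omega> \<le> u n)"
      "?ex j \<omega> \<and> (\<forall>m\<in>{j + 1..?r}. W m \<omega> \<le> u n)"
    show "i = j"
    proof (rule linorder_cases[of i j])
      assume "i < j" then have "j \<in> {i + 1..?r}" using * by auto
      then show ?thesis using * by fastforce
    next
      assume "j < i" then have "i \<in> {j + 1..?r}" using * by auto
      then show ?thesis using * by fastforce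
    qed
  qed auto
  finally have lower: "(\<Sum>j=1..?r. run_end n j) \<le> hit n + real ?r * e" by simp
  have "0 \<le> real T * c / real n" using c_nonneg by simp
  \<comment> \<open>That \<open>e\<close> is nonnegative is only known through \<open>err\<close>,
    hence only for a nonempty block.\<close>
  moreover have "0 \<le> real ?r * e"
  proof (cases "1 \<le> ?r")
    case True
    have "0 \<le> e" by (rule order_trans[OF _ err[of 1]]) (use True in auto)
    then show ?thesis by simp
  next
    case False
    then have "?r = 0" by simp
    then show ?thesis by simp
  qed
  ultimately show ?thesis using upper lower by linarith
qed

text \<open>After multiplication by \<open>k n\<close> the error \<open>blk n * e n\<close> becomes
  at most \<open>n * \<bar>e n\<bar>\<close>. Replacing \<open>k n * blk n\<close> by
  \<open>n\<close> in front of the run ends costs a second \<open>T c k n / n\<close>, since the run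
  ends of one period sum to at most \<open>T c / n\<close>; hence the factor 2 in
  \<open>?b\<close>.\<close>

lemma hit_asymp_run_ends:
  assumes e: "(\<lambda>n. real n * e n) \<longlonglongrightarrow> 0"
    and err: "\<And>n j. 1 \<le> n \<Longrightarrow> 1 \<le> j \<Longrightarrow> j \<le> blk n \<Longrightarrow>
    \<P>(\<omega> in M. W j \<omega> > u n \<and> (\<forall>i\<in>{j + 1..j + T}. W i \<omega> \<le> u n) \<and> (\<exists>i\<in>{j + T + 1..blk n}. W i \<omega> > u n)) \<le> e n"
  shows "(\<lambda>n. real (k n) * hit n - real n / real T * (\<Sum>i=1..T. run_end n i)) \<longlonglongrightarrow> 0"
proof (rule Lim_null_comparison)
  let ?b = "\<lambda>n. 2 * (real T * c * (real (k n) / real n)) + \<bar>real n * e n\<bar>"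
  show "\<forall>\<^sub>F n in sequentially.
     norm (real (k n) * hit n - real n / real T * (\<Sum>i=1..T. run_end n i)) \<le> ?b n"
    using eventually_ge_at_top[of 1]
  proof eventually_elim
    case (elim n)
    let ?S = "\<Sum>i=1..T. run_end n i"
    have kb: "real (k n) * real (blk n) \<le> real n"
      using k_blk_le[of n] by (metis of_nat_le_iff of_nat_mult)
    have kb': "real n \<le> real (k n) * real (blk n) + real (k n) * real T"
      using le_k_blk[of n] by (metis of_nat_le_iff of_nat_mult of_nat_add)
    have "\<bar>hit n - real (blk n) / real T * ?S\<bar> \<le> real T * c / real n + real (blk n) * \<bar>e n\<bar>"
      unfolding sum_run_end[OF elim, symmetric]
      by (rule hit_minus_run_ends[OF elim]) (rule order_trans[OF err[OF elim] abs_ge_self])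
    then have "real (k n) * \<bar>hit n - real (blk n) / real T * ?S\<bar> \<le> real (k n) * (real T * c / real n + real (blk n) * \<bar>e n\<bar>)"
      by (intro mult_left_mono) auto
    also have "\<dots> = real T * c * (real (k n) / real n) + (real (k n) * real (blk n)) * \<bar>e n\<bar>"
      by (simp add: algebra_simps)
    also have "\<dots> \<le> real T * c * (real (k n) / real n) + real n * \<bar>e n\<bar>"
      using kb by (intro add_left_mono mult_right_mono) auto
    finally have 1: "\<bar>real (k n) * hit n - real (k n) * (real (blk n) / real T * ?S)\<bar>
      \<le> real T * c * (real (k n) / real n) + \<bar>real n * e n\<bar>"
      by (simp only: abs_mult abs_of_nat flip: right_diff_distrib)
    have S0: "0 \<le> ?S" by (intro sum_nonneg) (simp add: run_end_def)
    have "run_end n i \<le> c / real n" if "1 \<le> i" for i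
    proof -
      have "run_end n i \<le> \<P>(\<omega> in M. W i \<omega> > u n)"
        unfolding run_end_def by (intro finite_measure_mono) auto
      also have "\<dots> \<le> c / real n" using exceed_bound[OF elim that] elim by (simp add: field_simps)
      finally show ?thesis .
    qed
    then have "?S \<le> (\<Sum>i=1..T. c / real n)" by (intro sum_mono) auto
    then have S1: "?S \<le> real T * (c / real n)" by simp
    have "\<bar>real (k n) * (real (blk n) / real T * ?S) - real n / real T * ?S\<bar>
      = (real n - real (k n) * real (blk n)) / real T * ?S"
      using mult_right_mono[OF kb S0] T_pos by (subst abs_of_nonpos) (auto simp: field_simps)
    also have "\<dots> \<le> (real (k n) * real T) / real T * ?S"
      using kb' S0 by (intro mult_right_mono divide_right_mono) auto
    also have "\<dots> = real (k n) * ?S" using T_pos by simp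
    also have "\<dots> \<le> real (k n) * (real T * (c / real n))" using S1 by (intro mult_left_mono) auto
    finally have 2: "\<bar>real (k n) * (real (blk n) / real T * ?S) - real n / real T * ?S\<bar>
      \<le> real T * c * (real (k n) / real n)" by (simp add: algebra_simps)
    have "\<bar>x - z\<bar> \<le> 2 * d + e" if "\<bar>x - y\<bar> \<le> d + e" "\<bar>y - z\<bar> \<le> d" for x y z d e :: real
      using that by linarith
    from this[OF 1 2] show ?case by (simp only: real_norm_def)
  qed
  have "?b \<longlonglongrightarrow> 2 * (real T * c * 0) + \<bar>0\<bar>"
    by (intro tendsto_intros k_small e)
  then show "?b \<longlonglongrightarrow> 0" by simp
qed

text \<open>Read from left to right for \<open>X\<close>, where the limit of the maxima is given,
  and from right to left for \<open>Y\<close>.\<close>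

lemma prob_max_tendsto_iff_run_ends:
  assumes "(\<lambda>n. real n * e n) \<longlonglongrightarrow> 0"
    and "\<And>n j. 1 \<le> n \<Longrightarrow> 1 \<le> j \<Longrightarrow> j \<le> blk n \<Longrightarrow>
    \<P>(\<omega> in M. W j \<omega> > u n \<and> (\<forall>i\<in>{j + 1..j + T}. W i \<omega> \<le> u n) \<and> (\<exists>i\<in>{j + T + 1..blk n}. W i \<omega> > u n)) \<le> e n"
  shows "(\<lambda>n. \<P>(\<omega> in M. \<forall>j\<in>{1..n}. W j \<omega> \<le> u n)) \<longlonglongrightarrow> exp (- s) \<longleftrightarrow>
    (\<lambda>n. real n / real T * (\<Sum>i=1..T. run_end n i)) \<longlonglongrightarrow> s"
  unfolding prob_max_tendsto_iff using hit_asymp_run_ends[OF assms] by (rule Lim_transform_eq)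

end

section \<open>Exceedances of the failure sequence\<close>

text \<open>\<open>E\<close> and \<open>V\<close> stand for \<open>{i. X i > c}\<close> and \<open>{i. U i = 1}\<close>; the predicate then says \<open>Y j > c\<close>.\<close>

definition failure_exceeds :: "nat \<Rightarrow> nat set \<Rightarrow> nat set \<Rightarrow> nat \<Rightarrow> bool" where
  "failure_exceeds T E V j \<longleftrightarrow>
     (if j \<in> V then j \<in> E else \<exists>i\<in>{(j - 1) div T * T..j - 1}. i \<in> V \<and> i \<in> E)"

text \<open>For \<open>c > 0\<close> a failed index enters the maximum with the value 0 and cannot
  exceed \<open>c\<close>, so only working indices count.\<close>

lemma failure_seq_gt_iff:
  assumes U: "\<And>i. U i \<omega> = 0 \<or> U i \<omega> = 1" and "0 < c"
  shows "failure_seq T U X j \<omega> > c \<longleftrightarrow> failure_exceeds T {i. X i \<omega> > c} {i. U i \<omega> = 1} j"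
proof (cases "U j \<omega> = 1")
  case True
  then show ?thesis by (simp add: failure_seq_def failure_exceeds_def)
next
  case False
  then have "U j \<omega> = 0" using U by blast
  moreover have "c < U i \<omega> * X i \<omega> \<longleftrightarrow> U i \<omega> = 1 \<and> c < X i \<omega>" for i
    using U[of i] \<open>0 < c\<close> by auto
  ultimately show ?thesis using False
    by (simp add: failure_seq_def failure_exceeds_def) (subst Max_gr_iff, auto)
qed

lemma failure_exceeds_cong:
  assumes "\<And>i. i \<le> j \<Longrightarrow> i \<in> E \<longleftrightarrow> i \<in> E'" "\<And>i. i \<le> j \<Longrightarrow> i \<in> V \<longleftrightarrow> i \<in> V'"
  shows "failure_exceeds T E V j \<longleftrightarrow> failure_exceeds T E' V' j"
  using assms unfolding failure_exceeds_def
  by (intro if_cong bex_cong refl) auto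

text \<open>The look-back window starts at a multiple of \<open>T\<close> and moves along with
  shifts by \<open>q * T\<close>. For \<open>j = 0\<close> the truncated \<open>j - 1\<close> would
  break this.\<close>

lemma failure_exceeds_shift:
  assumes "1 \<le> j" "0 < T"
  shows "failure_exceeds T E V (q * T + j) \<longleftrightarrow>
    failure_exceeds T {i. q * T + i \<in> E} {i. q * T + i \<in> V} j"
proof -
  obtain j' where j: "j = Suc j'" using assms by (cases j) auto
  have "(q * T + j' ) div T * T = q * T + j' div T * T"
    using assms by (simp add: algebra_simps)
  then have eq: "{(q * T + j - 1) div T * T..q * T + j - 1} = (+) (q * T) ` {(j - 1) div T * T..j - 1}"
    using j by (simp add: add.commute)
  show ?thesis unfolding failure_exceeds_def eq mem_Collect_eq by (intro if_cong refl) blast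
qed

text \<open>Once \<open>i\<close> is exceeded, every later failure of the same period reproduces the exceedance. So
  no exceedance after \<open>i\<close> forces \<open>{i+1..T} \<subseteq> V\<close>.\<close>

lemma failure_run_end_iff:
  assumes i: "1 \<le> i" "i < T" and V: "0 \<in> V" "T \<in> V"
  shows "failure_exceeds T E V i \<and> (\<forall>m\<in>{i + 1..i + T}. \<not> failure_exceeds T E V m) \<longleftrightarrow>
    (if i \<in> V then i \<in> E else \<exists>m\<in>{0..i - 1}. m \<in> V \<and> m \<in> E) \<and>
    {i + 1..T} \<subseteq> V \<and> (\<forall>m\<in>{i + 1..T}. m \<notin> E) \<and> (\<forall>m\<in>{T + 1..T + i}. m \<in> V \<longrightarrow> m \<notin> E)"
    (is "?l \<longleftrightarrow> ?r")
proof
  have first: "failure_exceeds T E V i \<longleftrightarrow> (if i \<in> V then i \<in> E else \<exists>m\<in>{0..i - 1}. m \<in> V \<and> m \<in> E)"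
    using i by (simp add: failure_exceeds_def)
  {
    assume l: ?l
    have inV: "m \<in> V" if "m \<in> {i + 1..T}" for m
    proof (rule ccontr)
      assume "m \<notin> V"
      with V that have m: "i < m" "m < T" by (auto simp: less_le)
      \<comment> \<open>Whether \<open>i\<close> works or fails, its exceedance originates from a
        working index \<open>m' \<le> i\<close>, which lies in the look-back window of
        \<open>m\<close>, as that window starts at 0.\<close>
      have "\<exists>m'\<le>i. m' \<in> V \<and> m' \<in> E"
        using l i unfolding first by (cases "i \<in> V") (auto, metis diff_le_self le_trans)
      then obtain m' where "m' \<le> i" "m' \<in> V" "m' \<in> E" by blast
      then have "failure_exceeds T E V m"
        using m \<open>m \<notin> V\<close> by (auto simp: failure_exceeds_def intro!: bexI[of _ m'])
      with l that i show False by auto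
    qed
    moreover have "m \<notin> E" if "m \<in> {i + 1..T}" for m
    proof -
      have "\<not> failure_exceeds T E V m" using that l by auto
      then show ?thesis using inV[OF that] by (simp add: failure_exceeds_def)
    qed
    moreover have "m \<notin> E" if "m \<in> {T + 1..T + i}" "m \<in> V" for m
    proof -
      have "\<not> failure_exceeds T E V m" using that l i by auto
      then show ?thesis using that by (simp add: failure_exceeds_def)
    qed
    ultimately show ?r using l unfolding first by auto
  }
  {
    assume r: ?r
    have "\<not> failure_exceeds T E V m" if "m \<in> {i + 1..i + T}" for m
    proof (cases "m \<in> V")
      case True
      then show ?thesis using r that by (cases "m \<le> T") (auto simp: failure_exceeds_def)
    next
      case False
      with r that have m: "T < m" "m \<le> T + i" by (force, auto)
      \<comment> \<open>The look-back window of a failure in the second period is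
        \<open>{T..m - 1}\<close>, whose working indices are all free of exceedances.\<close>
      have "(m - 1) div T = 1" using m i by (intro div_nat_eqI) auto
      then show ?thesis
        using False r m i by (auto simp: failure_exceeds_def)
    qed
    then show ?l using r unfolding first by auto
  }
qed

text \<open>As \<open>T\<close> works, an exceedance there is reproduced by any failure strictly
  between \<open>T\<close> and \<open>2 * T\<close>. So the whole following period has to
  work.\<close>

lemma failure_run_end_T_iff:
  assumes "0 < T" and V: "T \<in> V" "2 * T \<in> V"
  shows "failure_exceeds T E V T \<and> (\<forall>m\<in>{T + 1..T + T}. \<not> failure_exceeds T E V m) \<longleftrightarrow>
    T \<in> E \<and> {T..T + T} \<subseteq> V \<and> (\<forall>m\<in>{T + 1..T + T}. m \<notin> E)" (is "?l \<longleftrightarrow> ?r")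
proof
  assume l: ?l
  have T: "T \<in> E" using l V by (simp add: failure_exceeds_def)
  have inV: "m \<in> V" if "m \<in> {T + 1..T + T}" for m
  proof (rule ccontr)
    assume "m \<notin> V"
    with V that have m: "T < m" "m < T + T" by (auto simp: less_le mult_2)
    have "(m - 1) div T = 1" using m by (intro div_nat_eqI) auto
    then have "failure_exceeds T E V m"
      using m \<open>m \<notin> V\<close> V T by (auto simp: failure_exceeds_def intro!: bexI[of _ T])
    with l that show False by auto
  qed
  moreover have "m \<notin> E" if "m \<in> {T + 1..T + T}" for m
  proof -
    have "\<not> failure_exceeds T E V m" using that l by auto
    then show ?thesis using inV[OF that] by (simp add: failure_exceeds_def)
  qed
  moreover have "{T..T + T} = insert T {T + 1..T + T}" by auto
  ultimately show ?r using T V by auto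
next
  assume r: ?r
  then have "m \<in> V" "m \<notin> E" if "m \<in> {T + 1..T + T}" for m
    using that by (auto simp: subset_eq)
  with r V show ?l by (auto simp: failure_exceeds_def)
qed

text \<open>The run after \<open>j\<close> contains the working index \<open>b + T\<close>, which is
  therefore not in \<open>E\<close>. The exceedance at \<open>j\<close> stems from the period
  starting at \<open>b\<close>. The look-back window of \<open>i\<close> starts at
  \<open>b + T\<close> or later, so the exceedance at \<open>i\<close> stems from an index beyond
  \<open>b + T\<close>.\<close>

lemma failure_separated_exceedances:
  assumes T: "0 < T" and V: "\<And>m. m * T \<in> V"
    and j: "failure_exceeds T E V j" and gap: "\<forall>i\<in>{j + 1..j + T}. \<not> failure_exceeds T E V i"
    and i: "failure_exceeds T E V i" "j + T + 1 \<le> i"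
  defines "b \<equiv> j div T * T"
  shows "\<exists>m\<in>{b..b + T - 1}. m \<in> E" "b + T \<notin> E" "\<exists>m\<in>{b + T + 1..i}. m \<in> E"
proof -
  have b: "b \<le> j" "j < b + T"
    using T unfolding b_def by (auto simp: dividend_less_times_div mult.commute)
      (metis dividend_less_times_div mult.commute add.commute)
  have inV: "b + T \<in> V" using V[of "Suc (j div T)"] by (simp add: b_def add.commute)
  show notE: "b + T \<notin> E"
  proof -
    have "\<not> failure_exceeds T E V (b + T)" using gap b by auto
    with inV show ?thesis by (simp add: failure_exceeds_def)
  qed
  show "\<exists>m\<in>{b..b + T - 1}. m \<in> E"
  proof (cases "j \<in> V")
    case True
    then show ?thesis using j b by (intro bexI[of _ j]) (auto simp: failure_exceeds_def)
  next
    case False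
    \<comment> \<open>A failing \<open>j\<close> is no multiple of \<open>T\<close>, so
      \<open>j - 1\<close> lies in the same period.\<close>
    then have "b \<noteq> j" using V[of "j div T"] unfolding b_def by auto
    then have "b \<le> j - 1" using b by simp
    then have "(j - 1) div T = j div T"
      using b unfolding b_def by (intro div_nat_eqI) (auto simp: mult.commute)
    then have "\<exists>m\<in>{b..j - 1}. m \<in> E"
      using j False by (auto simp: failure_exceeds_def b_def)
    then show ?thesis using b by force
  qed
  have "b + T \<le> i - 1" using b i by simp
  then have "Suc (j div T) * T \<le> i - 1" by (simp add: b_def add.commute)
  then have "Suc (j div T) \<le> (i - 1) div T" using T by (simp add: less_eq_div_iff_mult_less_eq)
  then have "Suc (j div T) * T \<le> (i - 1) div T * T" by (rule mult_le_mono1)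
  then have b': "b + T \<le> (i - 1) div T * T" by (simp add: b_def add.commute)
  have le: "(i - 1) div T * T \<le> i" by (metis div_times_less_eq_dividend diff_le_self le_trans)
  have "\<exists>m\<in>{b + T..i}. m \<in> E"
  proof (cases "i \<in> V")
    case True
    then show ?thesis using i b' le by (intro bexI[of _ i]) (auto simp: failure_exceeds_def)
  next
    case False
    then obtain m where "m \<in> {(i - 1) div T * T..i - 1}" "m \<in> E"
      using i by (auto simp: failure_exceeds_def)
    then show ?thesis using b' by (intro bexI[of _ m]) auto
  qed
  then obtain m where m: "b + T \<le> m" "m \<le> i" "m \<in> E" by auto
  with notE have "m \<noteq> b + T" by auto
  with m show "\<exists>m\<in>{b + T + 1..i}. m \<in> E" by (intro bexI[of _ m]) auto
qed

section \<open>The probabilistic model\<close>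

text \<open>The probability that \<open>V\<close> is the set of those \<open>j \<in> K\<close> with \<open>U j = 1\<close>.\<close>

definition weight :: "nat \<Rightarrow> real \<Rightarrow> nat set \<Rightarrow> nat set \<Rightarrow> real" where
  "weight T p K V =
     (\<Prod>j\<in>K. if T dvd j then of_bool (j \<in> V) else if j \<in> V then p else 1 - p)"

lemma weight_non_multiples:
  assumes "finite K" and nm: "\<And>j. j \<in> K \<Longrightarrow> \<not> T dvd j"
  shows "weight T p K V = p ^ card (K \<inter> V) * (1 - p) ^ (card K - card (K \<inter> V))"
proof -
  have "weight T p K V = (\<Prod>j\<in>K. if j \<in> V then p else 1 - p)"
    unfolding weight_def using nm by (intro prod.cong) auto
  also have "\<dots> = (\<Prod>j\<in>K \<inter> V. p) * (\<Prod>j\<in>K - V. 1 - p)"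
    using assms(1) by (simp add: prod.If_cases Diff_eq Int_def)
  also have "card (K - V) = card K - card (K \<inter> V)"
    using assms(1) by (metis Diff_Int2 Int_absorb Int_commute card_Diff_subset_Int finite_Int)
  then have "(\<Prod>j\<in>K \<inter> V. p) * (\<Prod>j\<in>K - V. 1 - p) = p ^ card (K \<inter> V) * (1 - p) ^ (card K - card (K \<inter> V))"
    by simp
  finally show ?thesis .
qed

lemma weight_insert:
  "finite K \<Longrightarrow> j \<notin> K \<Longrightarrow> weight T p (insert j K) V =
     (if T dvd j then of_bool (j \<in> V) else if j \<in> V then p else 1 - p) * weight T p K V"
  unfolding weight_def by simp

locale failure_model = prob_space M for M :: "'w measure" +
  fixes U X :: "nat \<Rightarrow> 'w \<Rightarrow> real" and T :: nat and p :: real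
  assumes T_ge: "2 \<le> T" and p_pos: "0 < p" and p_less: "p < 1"
    and U_indep: "indep_vars (\<lambda>_. borel) U UNIV"
    and U_one: "\<And>m. AE \<omega> in M. U (m * T) \<omega> = 1"
    and U_bernoulli: "\<And>n. \<not> T dvd n \<Longrightarrow>
           distr M borel (U n) = distr (measure_pmf (bernoulli_pmf p)) borel of_bool"
    and X_stationary: "strictly_stationary M X"
    and XU_indep: "indep_var
           (PiM UNIV (\<lambda>_. borel)) (\<lambda>\<omega> n. X n \<omega>) (PiM UNIV (\<lambda>_. borel)) (\<lambda>\<omega> n. U n \<omega>)"
begin

lemma T_pos: "0 < T"
  using T_ge by simp

lemma X_meas[measurable]: "X n \<in> borel_measurable M"
  using X_stationary by (simp add: strictly_stationary_def)

lemma U_meas[measurable]: "U n \<in> borel_measurable M"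
  using U_indep by (simp add: indep_vars_def)

lemma Y_meas[measurable]: "failure_seq T U X n \<in> borel_measurable M"
  unfolding failure_seq_def by measurable

lemma U_law:
  assumes "\<not> T dvd n" "A \<in> sets borel"
  shows "\<P>(\<omega> in M. U n \<omega> \<in> A) = measure_pmf.prob (bernoulli_pmf p) {b. of_bool b \<in> A}"
proof -
  have "\<P>(\<omega> in M. U n \<omega> \<in> A) = measure (distr M borel (U n)) A"
    using assms(2) by (subst measure_distr) (auto intro!: arg_cong[where f = prob])
  also have "\<dots> = measure_pmf.prob (bernoulli_pmf p) {b. of_bool b \<in> A}"
    unfolding U_bernoulli[OF assms(1)] using assms(2)
    by (subst measure_distr) (auto simp: vimage_def)
  finally show ?thesis .
qed

text \<open>The Bernoulli law fixes the values of \<open>U n\<close> only almost surely;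
  countability of the indices gives one exceptional null set for all \<open>n\<close>.\<close>

lemma U_values: "AE \<omega> in M. \<forall>n. U n \<omega> = 0 \<or> U n \<omega> = 1"
proof (subst AE_all_countable, rule allI)
  fix n show "AE \<omega> in M. U n \<omega> = 0 \<or> U n \<omega> = 1"
  proof (cases "T dvd n")
    case True
    then obtain m where "n = m * T" by (metis dvd_def mult.commute)
    then show ?thesis using U_one[of m] by auto
  next
    case False
    have "\<P>(\<omega> in M. U n \<omega> \<in> {0, 1}) = 1"
      by (subst U_law[OF False]) auto
    then have "AE \<omega> in M. \<omega> \<in> {\<omega> \<in> space M. U n \<omega> \<in> {0, 1}}"
      by (subst AE_in_set_eq_1) auto
    then show ?thesis by eventually_elim auto
  qed
qed

lemma U_multiples: "AE \<omega> in M. \<forall>m. U (m * T) \<omega> = 1"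
  using U_one by (subst AE_all_countable) auto

lemma prob_U_eq_1:
  "\<P>(\<omega> in M. U n \<omega> = 1 \<longleftrightarrow> b) = (if T dvd n then of_bool b else if b then p else 1 - p)"
proof (cases "T dvd n")
  case True
  then obtain m where m: "n = m * T" by (metis dvd_def mult.commute)
  have "\<P>(\<omega> in M. U n \<omega> = 1) = 1" "\<P>(\<omega> in M. U n \<omega> \<noteq> 1) = 0"
    using U_one[of m] unfolding m by (subst prob_Collect_eq_1 prob_Collect_eq_0; simp)+
  then show ?thesis using True by (cases b) auto
next
  case False
  have "\<P>(\<omega> in M. U n \<omega> \<in> (if b then {1} else - {1})) = (if b then p else 1 - p)"
  proof (subst U_law[OF False])
    have "{x. of_bool x \<in> (if b then {1} else - {1::real})} = {b}" by (auto split: if_splits)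
    then show "measure_pmf.prob (bernoulli_pmf p) {x. of_bool x \<in> (if b then {1} else - {1::real})} =
      (if b then p else 1 - p)"
      using p_pos p_less by (simp add: measure_pmf_single)
  qed auto
  moreover have "{\<omega>\<in>space M. U n \<omega> \<in> (if b then {1} else - {1})} = {\<omega>\<in>space M. U n \<omega> = 1 \<longleftrightarrow> b}"
    by auto
  ultimately show ?thesis using False by simp
qed

lemma prob_U_pattern:
  assumes "finite K" "V \<subseteq> K"
  shows "\<P>(\<omega> in M. {j\<in>K. U (q * T + j) \<omega> = 1} = V) = weight T p K V"
\<comment> \<open>The product formula for independent variables is stated for nonempty index
  sets.\<close>
proof (cases "K = {}")
  case True
  then show ?thesis using assms by (simp add: weight_def prob_space)
next
  case False
  let ?A = "\<lambda>n. if n - q * T \<in> V then {1} else - {1::real}"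
  have "\<P>(\<omega> in M. {j\<in>K. U (q * T + j) \<omega> = 1} = V) =
    prob (\<Inter>n\<in>(+) (q * T) ` K. U n -` ?A n \<inter> space M)"
    using assms False by (intro arg_cong[where f = prob]) (auto split: if_splits)
  also have "\<dots> = (\<Prod>n\<in>(+) (q * T) ` K. prob (U n -` ?A n \<inter> space M))"
    using assms False by (intro indep_varsD[OF U_indep]) auto
  also have "\<dots> = (\<Prod>j\<in>K. prob (U (q * T + j) -` ?A (q * T + j) \<inter> space M))"
    by (subst prod.reindex) auto
  also have "\<dots> = weight T p K V"
    unfolding weight_def
  proof (rule prod.cong[OF refl])
    fix j
    have "prob (U (q * T + j) -` ?A (q * T + j) \<inter> space M) = \<P>(\<omega> in M. U (q * T + j) \<omega> = 1 \<longleftrightarrow> j \<in> V)"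
      by (intro arg_cong[where f = prob]) auto
    \<comment> \<open>Adding \<open>q * T\<close> does not affect divisibility by \<open>T\<close>,
      so the weight is the same for all \<open>q\<close>.\<close>
    also have "\<dots> = (if T dvd j then of_bool (j \<in> V) else if j \<in> V then p else 1 - p)"
      unfolding prob_U_eq_1 by simp
    finally show "prob (U (q * T + j) -` ?A (q * T + j) \<inter> space M) =
      (if T dvd j then of_bool (j \<in> V) else if j \<in> V then p else 1 - p)" .
  qed
  finally show ?thesis .
qed

lemma prob_X_pattern:
  assumes "finite J"
  shows "\<P>(\<omega> in M. Q {j\<in>J. X (h + j) \<omega> > c}) = \<P>(\<omega> in M. Q {j\<in>J. X j \<omega> > c})"
proof -
  let ?A = "{x\<in>space (PiM J (\<lambda>_. borel)). Q {j\<in>J. x j > (c::real)}}"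
  have A: "?A \<in> sets (PiM J (\<lambda>_. borel))"
    using pred_finite_pattern[OF assms, of "\<lambda>j x. x j > c" "PiM J (\<lambda>_. borel)" Q] by simp
  have *: "measure (distr M (PiM J (\<lambda>_. borel)) (\<lambda>\<omega>. \<lambda>j\<in>J. X (j + h) \<omega>)) ?A =
    \<P>(\<omega> in M. Q {j\<in>J. X (h + j) \<omega> > c})" for h
    using A by (subst measure_distr)
      (auto intro!: arg_cong[where f = prob] arg_cong[where f = Q] simp: space_PiM add.commute cong: conj_cong)
  have "distr M (PiM J (\<lambda>_. borel)) (\<lambda>\<omega>. \<lambda>j\<in>J. X (j + h) \<omega>) =
    distr M (PiM J (\<lambda>_. borel)) (\<lambda>\<omega>. \<lambda>j\<in>J. X (j + 0) \<omega>)"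
    using X_stationary assms by (simp add: strictly_stationary_def)
  then show ?thesis using *[of h] *[of 0] by simp
qed

text \<open>Independence of the two sequences factorises the event, stationarity removes the shift
  from \<open>X\<close>, and the weight does not see it. As \<open>V\<close> is fixed,
  \<open>Q\<close> may depend on it; this is how joint events are treated.\<close>

lemma prob_XU_pattern:
  assumes J: "finite J" and K: "finite K" "V \<subseteq> K"
  shows "\<P>(\<omega> in M. Q {j\<in>J. X (q * T + j) \<omega> > c} \<and> {j\<in>K. U (q * T + j) \<omega> = 1} = V) =
    \<P>(\<omega> in M. Q {j\<in>J. X j \<omega> > c}) * weight T p K V"
proof -
  let ?S = "PiM UNIV (\<lambda>_::nat. borel) :: (nat \<Rightarrow> real) measure"
  let ?A = "{x\<in>space ?S. Q {j\<in>J. x (q * T + j) > c}}" and ?B = "{x\<in>space ?S. {j\<in>K. x (q * T + j) = 1} = V}"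
  have A: "?A \<in> sets ?S"
    using pred_finite_pattern[OF J, of "\<lambda>j x. x (q * T + j) > c" ?S Q] by simp
  have B: "?B \<in> sets ?S"
    using pred_finite_pattern[OF K(1), of "\<lambda>j x. x (q * T + j) = 1" ?S "\<lambda>E. E = V"] by simp
  have "\<P>(\<omega> in M. Q {j\<in>J. X (q * T + j) \<omega> > c} \<and> {j\<in>K. U (q * T + j) \<omega> = 1} = V) =
    prob ((\<lambda>\<omega>. (\<lambda>n. X n \<omega>, \<lambda>n. U n \<omega>)) -` (?A \<times> ?B) \<inter> space M)"
    by (intro arg_cong[where f = prob]) (auto simp: space_PiM)
  also have "\<dots> = prob ((\<lambda>\<omega> n. X n \<omega>) -` ?A \<inter> space M) * prob ((\<lambda>\<omega> n. U n \<omega>) -` ?B \<inter> space M)"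
    by (rule indep_varD[OF XU_indep A B])
  also have "(\<lambda>\<omega> n. X n \<omega>) -` ?A \<inter> space M = {\<omega>\<in>space M. Q {j\<in>J. X (q * T + j) \<omega> > c}}"
    by (auto simp: space_PiM)
  also have "(\<lambda>\<omega> n. U n \<omega>) -` ?B \<inter> space M = {\<omega>\<in>space M. {j\<in>K. U (q * T + j) \<omega> = 1} = V}"
    by (auto simp: space_PiM)
  finally show ?thesis using prob_X_pattern[OF J] prob_U_pattern[OF K] by simp
qed

lemma pred_XU_pattern:
  assumes "finite J" "finite K"
  shows "Measurable.pred M (\<lambda>\<omega>. R {j\<in>J. X (f j) \<omega> > c} {j\<in>K. U (g j) \<omega> = 1})"
proof -
  have "(\<lambda>\<omega>. R {j\<in>J. X (f j) \<omega> > c} {j\<in>K. U (g j) \<omega> = 1}) =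
    (\<lambda>\<omega>. \<exists>V\<in>Pow K. (\<lambda>E. R E V) {j\<in>J. X (f j) \<omega> > c} \<and> (\<lambda>E. E = V) {j\<in>K. U (g j) \<omega> = 1})"
    by (intro ext) auto
  also have "Measurable.pred M \<dots>"
    using assms by (intro pred_intros_finite pred_intros_logic pred_finite_pattern) auto
  finally show ?thesis .
qed

lemma prob_sum_U_pattern:
  assumes "finite K" "Measurable.pred M Q"
  shows "\<P>(\<omega> in M. Q \<omega>) = (\<Sum>V\<in>Pow K. \<P>(\<omega> in M. Q \<omega> \<and> {j\<in>K. U (g j) \<omega> = 1} = V))"
proof (rule prob_sum)
  fix V
  have "Measurable.pred M (\<lambda>\<omega>. (\<lambda>E. E = V) {j\<in>K. U (g j) \<omega> = 1})"
    using assms(1) by (intro pred_finite_pattern) auto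
  then show "{\<omega>\<in>space M. Q \<omega> \<and> {j\<in>K. U (g j) \<omega> = 1} = V} \<in> events"
    using assms(2) by measurable
  show "{\<omega>\<in>space M. Q \<omega>} \<in> events" using assms(2) by measurable
qed (use assms in auto)

text \<open>Total probability over the patterns of \<open>U\<close>. The right-hand side is free of
  \<open>q\<close>, which is the source of the periodicity of \<open>Y\<close>.\<close>

lemma prob_XU:
  assumes J: "finite J" and K: "finite K"
  shows "\<P>(\<omega> in M. R {j\<in>J. X (q * T + j) \<omega> > c} {j\<in>K. U (q * T + j) \<omega> = 1}) =
    (\<Sum>V\<in>Pow K. \<P>(\<omega> in M. R {j\<in>J. X j \<omega> > c} V) * weight T p K V)"
proof -
  have "\<P>(\<omega> in M. R {j\<in>J. X (q * T + j) \<omega> > c} {j\<in>K. U (q * T + j) \<omega> = 1}) =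
    (\<Sum>V\<in>Pow K. \<P>(\<omega> in M. R {j\<in>J. X (q * T + j) \<omega> > c} {j\<in>K. U (q * T + j) \<omega> = 1} \<and>
      {j\<in>K. U (q * T + j) \<omega> = 1} = V))"
    using assms by (intro prob_sum_U_pattern pred_XU_pattern)
  also have "\<dots> = (\<Sum>V\<in>Pow K. \<P>(\<omega> in M. R {j\<in>J. X j \<omega> > c} V) * weight T p K V)"
  proof (rule sum.cong[OF refl])
    fix V assume "V \<in> Pow K"
    then have "V \<subseteq> K" by simp
    have "\<P>(\<omega> in M. R {j\<in>J. X (q * T + j) \<omega> > c} {j\<in>K. U (q * T + j) \<omega> = 1} \<and>
      {j\<in>K. U (q * T + j) \<omega> = 1} = V) =
      \<P>(\<omega> in M. (\<lambda>E. R E V) {j\<in>J. X (q * T + j) \<omega> > c} \<and> {j\<in>K. U (q * T + j) \<omega> = 1} = V)"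
      by (intro arg_cong[where f = prob]) auto
    also have "\<dots> = \<P>(\<omega> in M. R {j\<in>J. X j \<omega> > c} V) * weight T p K V"
      by (rule prob_XU_pattern[OF J K \<open>V \<subseteq> K\<close>])
    finally show "\<P>(\<omega> in M. R {j\<in>J. X (q * T + j) \<omega> > c} {j\<in>K. U (q * T + j) \<omega> = 1} \<and>
      {j\<in>K. U (q * T + j) \<omega> = 1} = V) = \<P>(\<omega> in M. R {j\<in>J. X j \<omega> > c} V) * weight T p K V" .
  qed
  finally show ?thesis .
qed

lemma Y_exceeds:
  assumes "0 < c"
  shows "AE \<omega> in M. \<forall>j. failure_seq T U X j \<omega> > c \<longleftrightarrow>
    failure_exceeds T {i. X i \<omega> > c} {i. U i \<omega> = 1} j"
  using U_values by eventually_elim (intro allI failure_seq_gt_iff assms, simp)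

text \<open>Up to a null set the exceedances of \<open>Y\<close> on \<open>J\<close> are a function
  of the patterns of \<open>X\<close> and \<open>U\<close> on \<open>{..m}\<close>, and the same
  function describes them after a shift by \<open>q * T\<close>.\<close>

lemma prob_Y_periodic:
  assumes c: "0 < c" and J: "finite J" "0 \<notin> J"
  shows "\<P>(\<omega> in M. Q {j\<in>J. failure_seq T U X (q * T + j) \<omega> > c}) =
    \<P>(\<omega> in M. Q {j\<in>J. failure_seq T U X j \<omega> > c})"
proof -
  obtain m where m: "J \<subseteq> {..m}" using J(1) finite_nat_iff_bounded_le by blast
  define R where "R = (\<lambda>E V. Q {j\<in>J. failure_exceeds T E V j})"
  have "\<P>(\<omega> in M. Q {j\<in>J. failure_seq T U X (q * T + j) \<omega> > c}) =
    \<P>(\<omega> in M. R {j\<in>{..m}. X (q * T + j) \<omega> > c} {j\<in>{..m}. U (q * T + j) \<omega> = 1})" for q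
  proof (rule finite_measure_eq_AE)
    show "{\<omega>\<in>space M. Q {j\<in>J. failure_seq T U X (q * T + j) \<omega> > c}} \<in> events"
      using pred_finite_pattern[OF J(1), of "\<lambda>j \<omega>. failure_seq T U X (q * T + j) \<omega> > c" M Q] by simp
    show "{\<omega>\<in>space M. R {j\<in>{..m}. X (q * T + j) \<omega> > c} {j\<in>{..m}. U (q * T + j) \<omega> = 1}} \<in> events"
      using pred_XU_pattern[of "{..m}" "{..m}" R c "\<lambda>j. q * T + j" "\<lambda>j. q * T + j"] by simp
    show "AE \<omega> in M. \<omega> \<in> {\<omega>\<in>space M. Q {j\<in>J. failure_seq T U X (q * T + j) \<omega> > c}} \<longleftrightarrow>
      \<omega> \<in> {\<omega>\<in>space M. R {j\<in>{..m}. X (q * T + j) \<omega> > c} {j\<in>{..m}. U (q * T + j) \<omega> = 1}}"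
      using Y_exceeds[OF c]
    proof eventually_elim
      case (elim \<omega>)
      have "{j\<in>J. failure_seq T U X (q * T + j) \<omega> > c} = {j\<in>J. failure_exceeds T
        {j\<in>{..m}. X (q * T + j) \<omega> > c} {j\<in>{..m}. U (q * T + j) \<omega> = 1} j}"
      proof (rule Collect_cong, rule conj_cong[OF refl])
        fix j assume "j \<in> J"
        then have j: "1 \<le> j" "j \<le> m" using J m by (auto simp: Suc_le_eq intro: gr0I)
        have "failure_seq T U X (q * T + j) \<omega> > c \<longleftrightarrow>
          failure_exceeds T {i. X (q * T + i) \<omega> > c} {i. U (q * T + i) \<omega> = 1} j"
          using elim failure_exceeds_shift[OF j(1) T_pos] by simp
        also have "\<dots> \<longleftrightarrow> failure_exceeds T {j\<in>{..m}. X (q * T + j) \<omega> > c} {j\<in>{..m}. U (q * T + j) \<omega> = 1} j"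
          using j by (intro failure_exceeds_cong) auto
        finally show "failure_seq T U X (q * T + j) \<omega> > c \<longleftrightarrow>
          failure_exceeds T {j\<in>{..m}. X (q * T + j) \<omega> > c} {j\<in>{..m}. U (q * T + j) \<omega> = 1} j" .
      qed
      then show ?case by (simp add: R_def)
    qed
  qed
  then have "\<P>(\<omega> in M. Q {j\<in>J. failure_seq T U X (q * T + j) \<omega> > c}) =
    (\<Sum>V\<in>Pow {..m}. \<P>(\<omega> in M. R {j\<in>{..m}. X j \<omega> > c} V) * weight T p {..m} V)" for q
    by (simp only: prob_XU finite_atMost)
  from this[of q] this[of 0] show ?thesis by simp
qed

end

section \<open>Patterns of working indices over two periods and their weights\<close>

lemma pattern_Un_iff:
  assumes "A \<inter> B = {}" "I \<subseteq> B" "J \<subseteq> A"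
  shows "{j\<in>A \<union> B. j \<in> V} = J \<union> I \<longleftrightarrow> {j\<in>A. j \<in> V} = J \<and> {j\<in>B. j \<in> V} = I"
  using assms by blast

text \<open>If \<open>i\<close> works, earlier indices have no influence on the run end, so the
  pattern is recorded from \<open>i\<close> on. The indices up to \<open>T\<close> are forced to
  work; \<open>I\<close> is the free part.\<close>

lemma working_pattern_iff:
  fixes i T :: nat
  assumes i: "1 \<le> i" "i < T" and I: "I \<subseteq> {T + 1..T + i}"
  shows "{j\<in>{i..T + i}. j \<in> V} = {i..T} \<union> I \<longleftrightarrow>
    i \<in> V \<and> {i + 1..T} \<subseteq> V \<and> {j\<in>{T + 1..T + i}. j \<in> V} = I"
proof -
  have "{i..T + i} = {i..T} \<union> {T + 1..T + i}" using i by auto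
  then have "{j\<in>{i..T + i}. j \<in> V} = {i..T} \<union> I \<longleftrightarrow>
      {j\<in>{i..T}. j \<in> V} = {i..T} \<and> {j\<in>{T + 1..T + i}. j \<in> V} = I"
    using pattern_Un_iff[of "{i..T}" "{T + 1..T + i}" I "{i..T}" V] I by simp
  also have "{j\<in>{i..T}. j \<in> V} = {i..T} \<longleftrightarrow> {i..T} \<subseteq> V" by blast
  also have "\<dots> \<longleftrightarrow> i \<in> V \<and> {i + 1..T} \<subseteq> V"
  proof -
    have "{i..T} = insert i {i + 1..T}" using i by auto
    then show ?thesis by simp
  qed
  finally show ?thesis by (simp only: conj_assoc)
qed

text \<open>If \<open>i\<close> fails, its value comes from \<open>{0..i - 1}\<close>, so the
  pattern is recorded from 0 on. Index 0 always works and accompanies the free part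
  \<open>J\<close>.\<close>

lemma failing_pattern_iff:
  fixes i T :: nat
  assumes i: "1 \<le> i" "i < T" and I: "I \<subseteq> {T + 1..T + i}" and J: "J \<subseteq> {1..i - 1}"
  shows "{j\<in>{0..T + i}. j \<in> V} = (J \<union> {0}) \<union> ({i + 1..T} \<union> I) \<longleftrightarrow>
    0 \<in> V \<and> i \<notin> V \<and> {i + 1..T} \<subseteq> V \<and> {j\<in>{1..i - 1}. j \<in> V} = J \<and> {j\<in>{T + 1..T + i}. j \<in> V} = I"
proof -
  have eq: "{0..T + i} = {0..i} \<union> ({i + 1..T} \<union> {T + 1..T + i})" using i by auto
  have "{j\<in>{0..T + i}. j \<in> V} = (J \<union> {0}) \<union> ({i + 1..T} \<union> I) \<longleftrightarrow>
      {j\<in>{0..i}. j \<in> V} = J \<union> {0} \<and> {j\<in>{i + 1..T} \<union> {T + 1..T + i}. j \<in> V} = {i + 1..T} \<union> I"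
    unfolding eq using I J i by (intro pattern_Un_iff) fastforce+
  also have "{j\<in>{i + 1..T} \<union> {T + 1..T + i}. j \<in> V} = {i + 1..T} \<union> I \<longleftrightarrow>
      {j\<in>{i + 1..T}. j \<in> V} = {i + 1..T} \<and> {j\<in>{T + 1..T + i}. j \<in> V} = I"
    using I by (intro pattern_Un_iff) auto
  also have "{j\<in>{i + 1..T}. j \<in> V} = {i + 1..T} \<longleftrightarrow> {i + 1..T} \<subseteq> V" by blast
  also have "{j\<in>{0..i}. j \<in> V} = J \<union> {0} \<longleftrightarrow> 0 \<in> V \<and> i \<notin> V \<and> {j\<in>{1..i - 1}. j \<in> V} = J"
  proof -
    have "{0..i} = {1..i - 1} \<union> {0, i}" using i by auto
    moreover have "0 \<notin> J" "i \<notin> J" using J i by auto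
    ultimately show ?thesis using J i by (simp only: set_eq_iff mem_Collect_eq Un_iff) auto
  qed
  finally show ?thesis by blast
qed

text \<open>Index \<open>T\<close> contributes the factor 1. Of the other \<open>T\<close> indices,
  the \<open>T - i\<close> ones below \<open>T\<close> and those in \<open>I\<close> work, which
  leaves \<open>i - card I\<close> failures.\<close>

lemma weight_working_pattern:
  assumes i: "1 \<le> i" "i < T" and I: "I \<subseteq> {T + 1..T + i}"
  shows "weight T p {i..T + i} ({i..T} \<union> I) = p ^ (card I + T - i) * (1 - p) ^ (i - card I)"
proof -
  have nm: "\<not> T dvd j" if "j \<in> {i..T - 1} \<union> {T + 1..T + i}" for j
  proof
    assume "T dvd j"
    then obtain m where m: "j = T * m" by (auto elim: dvdE)
    have "j \<noteq> 0" "j \<noteq> T" "j < T * 2" using that i by auto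
    then have "m \<noteq> 0" "m \<noteq> 1" "m < 2" using i unfolding m by auto
    then show False by auto
  qed
  have fin: "finite I" using I finite_subset by auto
  have cI: "card I \<le> i" using card_mono[OF _ I] by simp
  have disj: "{i..T - 1} \<inter> I = {}" using I i by fastforce
  have "{i..T + i} = insert T ({i..T - 1} \<union> {T + 1..T + i})" using i by auto
  then have "weight T p {i..T + i} ({i..T} \<union> I) = weight T p ({i..T - 1} \<union> {T + 1..T + i}) ({i..T} \<union> I)"
    using i by (simp only:, subst weight_insert) auto
  also have "\<dots> = p ^ card (({i..T - 1} \<union> {T + 1..T + i}) \<inter> ({i..T} \<union> I)) *
    (1 - p) ^ (card ({i..T - 1} \<union> {T + 1..T + i}) - card (({i..T - 1} \<union> {T + 1..T + i}) \<inter> ({i..T} \<union> I)))"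
    using nm by (intro weight_non_multiples) auto
  also have "({i..T - 1} \<union> {T + 1..T + i}) \<inter> ({i..T} \<union> I) = {i..T - 1} \<union> I"
    using I i by auto
  also have "card ({i..T - 1} \<union> I) = T - i + card I"
    using i fin disj by (subst card_Un_disjoint) auto
  also have "card ({i..T - 1} \<union> {T + 1..T + i}) = T"
    using i by (subst card_Un_disjoint) auto
  also have "T - i + card I = card I + T - i" using i by simp
  also have "T - (card I + T - i) = i - card I" using i cI by simp
  finally show ?thesis .
qed

text \<open>Indices 0 and \<open>T\<close> contribute the factor 1, and \<open>T - 1 + i\<close>
  others remain. Those in \<open>J\<close> and \<open>I\<close> and the \<open>T - 1 - i\<close>
  ones strictly between \<open>i\<close> and \<open>T\<close> work; the remaining
  \<open>2 * i - card I - card J\<close>, among them \<open>i\<close> itself, fail.\<close>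

lemma weight_failing_pattern:
  assumes i: "1 \<le> i" "i < T" and I: "I \<subseteq> {T + 1..T + i}" and J: "J \<subseteq> {1..i - 1}"
  shows "weight T p {0..T + i} ((J \<union> {0}) \<union> ({i + 1..T} \<union> I)) =
    p ^ (card I + card J + T - i - 1) * (1 - p) ^ (2 * i - card I - card J)"
proof -
  let ?K = "{1..T - 1} \<union> {T + 1..T + i}" and ?V = "(J \<union> {0}) \<union> ({i + 1..T} \<union> I)"
  have nm: "\<not> T dvd j" if "j \<in> ?K" for j
  proof
    assume "T dvd j"
    then obtain m where m: "j = T * m" by (auto elim: dvdE)
    have "j \<noteq> 0" "j \<noteq> T" "j < T * 2" using that i by auto
    then have "m \<noteq> 0" "m \<noteq> 1" "m < 2" using i unfolding m by auto
    then show False by auto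
  qed
  have fin: "finite I" "finite J" using I J finite_subset by auto
  have cI: "card I \<le> i" using card_mono[OF _ I] by simp
  have cJ: "card J \<le> i - 1" using card_mono[OF _ J] by simp
  have I': "T + 1 \<le> x" "x \<le> T + i" if "x \<in> I" for x using I that by auto
  have J': "1 \<le> x" "x \<le> i - 1" if "x \<in> J" for x using J that by auto
  have disj: "{i + 1..T - 1} \<inter> I = {}" using I i by fastforce
  have disj': "J \<inter> ({i + 1..T - 1} \<union> I) = {}" using I J i by fastforce
  have "{0..T + i} = insert 0 (insert T ?K)" using i by auto
  then have "weight T p {0..T + i} ?V = weight T p ?K ?V"
    using i by (simp only:, subst weight_insert, simp, simp, subst weight_insert) auto
  also have "\<dots> = p ^ card (?K \<inter> ?V) * (1 - p) ^ (card ?K - card (?K \<inter> ?V))"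
    using nm by (intro weight_non_multiples) auto
  also have "?K \<inter> ?V = J \<union> ({i + 1..T - 1} \<union> I)"
  proof (intro set_eqI iffI)
    fix x assume "x \<in> J \<union> ({i + 1..T - 1} \<union> I)"
    then show "x \<in> ?K \<inter> ?V" using i by (fastforce dest: I' J')
  next
    fix x assume "x \<in> ?K \<inter> ?V"
    then show "x \<in> J \<union> ({i + 1..T - 1} \<union> I)" using i by auto
  qed
  also have "card (J \<union> ({i + 1..T - 1} \<union> I)) = card J + card ({i + 1..T - 1} \<union> I)"
    using fin disj' by (intro card_Un_disjoint) auto
  also have "card ({i + 1..T - 1} \<union> I) = T - 1 - i + card I"
    using i fin disj by (subst card_Un_disjoint) auto
  also have "card ?K = T - 1 + i"
    using i by (subst card_Un_disjoint) auto
  also have "card J + (T - 1 - i + card I) = card I + card J + T - i - 1" using i by simp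
  also have "T - 1 + i - (card I + card J + T - i - 1) = 2 * i - card I - card J" using i cI cJ by simp
  finally show ?thesis .
qed

section \<open>Exceedances and run ends of \<open>Y\<close> in terms of \<open>X\<close>\<close>

context failure_model
begin

abbreviation "Y \<equiv> failure_seq T U X"

lemma prob_cong_AE:
  assumes "Measurable.pred M P" "Measurable.pred M Q" "AE \<omega> in M. P \<omega> \<longleftrightarrow> Q \<omega>"
  shows "\<P>(\<omega> in M. P \<omega>) = \<P>(\<omega> in M. Q \<omega>)"
  using assms by (intro finite_measure_eq_AE) (auto elim!: eventually_mono)

lemma prob_X_eq: "\<P>(\<omega> in M. X j \<omega> > c) = \<P>(\<omega> in M. X 0 \<omega> > c)"
  using prob_X_pattern[where J = "{0}" and Q = "\<lambda>E. E \<noteq> {}" and h = j and c = c] by simp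

lemma U_0_T: "AE \<omega> in M. U 0 \<omega> = 1 \<and> U T \<omega> = 1 \<and> U (2 * T) \<omega> = 1"
  using U_multiples
proof eventually_elim
  case (elim \<omega>)
  show ?case using elim[rule_format, of 0] elim[rule_format, of 1] elim[rule_format, of 2] by simp
qed

text \<open>\<open>U j\<close> is independent of \<open>X\<close> and of the \<open>U i\<close> with
  \<open>i \<in> K\<close>, so a failure at \<open>j\<close> splits off as a factor. Patterns that
  contain \<open>j\<close> drop out of the sum.\<close>

lemma prob_failure:
  assumes "finite J" "finite K" "j \<notin> K" "\<not> T dvd j"
  shows "\<P>(\<omega> in M. U j \<omega> \<noteq> 1 \<and> R {i\<in>J. X i \<omega> > c} {i\<in>K. U i \<omega> = 1}) =
    (1 - p) * \<P>(\<omega> in M. R {i\<in>J. X i \<omega> > c} {i\<in>K. U i \<omega> = 1})"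
proof -
  let ?R = "\<lambda>E V. j \<notin> V \<and> R E (V \<inter> K)"
  have "\<P>(\<omega> in M. U j \<omega> \<noteq> 1 \<and> R {i\<in>J. X i \<omega> > c} {i\<in>K. U i \<omega> = 1}) =
    \<P>(\<omega> in M. ?R {i\<in>J. X (0 * T + i) \<omega> > c} {i\<in>insert j K. U (0 * T + i) \<omega> = 1})"
    using assms by (intro arg_cong[where f = prob] Collect_cong conj_cong refl arg_cong2[where f = R]) auto
  also have "\<dots> = (\<Sum>V\<in>Pow (insert j K). \<P>(\<omega> in M. ?R {i\<in>J. X i \<omega> > c} V) * weight T p (insert j K) V)"
    using assms by (intro prob_XU) auto
  also have "\<dots> = (\<Sum>V\<in>Pow K. \<P>(\<omega> in M. ?R {i\<in>J. X i \<omega> > c} V) * weight T p (insert j K) V)"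
    using assms by (intro sum.mono_neutral_right) auto
  also have "\<dots> = (\<Sum>V\<in>Pow K. (1 - p) * (\<P>(\<omega> in M. R {i\<in>J. X i \<omega> > c} V) * weight T p K V))"
  proof (rule sum.cong[OF refl])
    fix V assume V: "V \<in> Pow K"
    then have "j \<notin> V" "V \<inter> K = V" using assms by auto
    then show "\<P>(\<omega> in M. ?R {i\<in>J. X i \<omega> > c} V) * weight T p (insert j K) V =
      (1 - p) * (\<P>(\<omega> in M. R {i\<in>J. X i \<omega> > c} V) * weight T p K V)"
      using assms by (simp add: weight_insert)
  qed
  also have "\<dots> = (1 - p) * \<P>(\<omega> in M. R {i\<in>J. X i \<omega> > c} {i\<in>K. U i \<omega> = 1})"
    using prob_XU[OF assms(1,2), where R = R and q = 0 and c = c] by (simp add: sum_distrib_left)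
  finally show ?thesis .
qed

text \<open>A working index shows \<open>X j\<close>, a failing one the maximum over
  \<open>{0..j - 1}\<close>, whose distribution function is the \<open>G j\<close> of the theorem.
  This is the origin of the formula for \<tau>.\<close>

lemma prob_Y_exceeds:
  assumes c: "0 < c" and j: "1 \<le> j" "j < T"
  shows "\<P>(\<omega> in M. Y j \<omega> > c) = p * \<P>(\<omega> in M. X 0 \<omega> > c) +
    (1 - p) * \<P>(\<omega> in M. Max ((\<lambda>i. U i \<omega> * X i \<omega>) ` {0..j - 1}) > c)"
proof -
  let ?R = "\<lambda>E V. \<exists>i\<in>{0..j - 1}. i \<in> V \<and> i \<in> E"
  have nd: "\<not> T dvd j" using j by (auto dest: dvd_imp_le)
  have div: "(j - Suc 0) div T = 0" using j by simp
  have "\<P>(\<omega> in M. Y j \<omega> > c) =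
    \<P>(\<omega> in M. Y j \<omega> > c \<and> U j \<omega> = 1) + \<P>(\<omega> in M. Y j \<omega> > c \<and> \<not> U j \<omega> = 1)"
    by (rule prob_conj_not) measurable
  also have "\<P>(\<omega> in M. Y j \<omega> > c \<and> U j \<omega> = 1) =
    \<P>(\<omega> in M. (\<lambda>E. j \<in> E) {i\<in>{j}. X (0 * T + i) \<omega> > c} \<and> {i\<in>{j}. U (0 * T + i) \<omega> = 1} = {j})"
  proof (rule arg_cong[where f = prob], rule Collect_cong, rule conj_cong[OF refl])
    fix \<omega>
    have "{i\<in>{j}. U (0 * T + i) \<omega> = 1} = {j} \<longleftrightarrow> U j \<omega> = 1" by auto
    then show "(Y j \<omega> > c \<and> U j \<omega> = 1) \<longleftrightarrow>
      ((\<lambda>E. j \<in> E) {i\<in>{j}. X (0 * T + i) \<omega> > c} \<and> {i\<in>{j}. U (0 * T + i) \<omega> = 1} = {j})"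
      by (auto simp: failure_seq_def)
  qed
  also have "\<dots> = \<P>(\<omega> in M. j \<in> {i\<in>{j}. X i \<omega> > c}) * weight T p {j} {j}"
    by (rule prob_XU_pattern) auto
  also have "\<dots> = p * \<P>(\<omega> in M. X 0 \<omega> > c)"
    using nd by (simp add: weight_def prob_X_eq[where j = j])
  also have "\<P>(\<omega> in M. Y j \<omega> > c \<and> \<not> U j \<omega> = 1) =
    \<P>(\<omega> in M. U j \<omega> \<noteq> 1 \<and> ?R {i\<in>{0..j - 1}. X i \<omega> > c} {i\<in>{0..j - 1}. U i \<omega> = 1})"
  proof (rule prob_cong_AE)
    show "AE \<omega> in M. (Y j \<omega> > c \<and> \<not> U j \<omega> = 1) \<longleftrightarrow>
      (U j \<omega> \<noteq> 1 \<and> ?R {i\<in>{0..j - 1}. X i \<omega> > c} {i\<in>{0..j - 1}. U i \<omega> = 1})"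
      using Y_exceeds[OF c] 
    proof eventually_elim
      case (elim \<omega>)
      show ?case using elim[rule_format, of j] by (auto simp: failure_exceeds_def div)
    qed
  qed measurable
  also have "\<dots> = (1 - p) * \<P>(\<omega> in M. ?R {i\<in>{0..j - 1}. X i \<omega> > c} {i\<in>{0..j - 1}. U i \<omega> = 1})"
    using j nd by (intro prob_failure[where R = ?R]) auto
  also have "\<P>(\<omega> in M. ?R {i\<in>{0..j - 1}. X i \<omega> > c} {i\<in>{0..j - 1}. U i \<omega> = 1}) =
    \<P>(\<omega> in M. Max ((\<lambda>i. U i \<omega> * X i \<omega>) ` {0..j - 1}) > c)"
  proof (rule prob_cong_AE)
    show "AE \<omega> in M. ?R {i\<in>{0..j - 1}. X i \<omega> > c} {i\<in>{0..j - 1}. U i \<omega> = 1} \<longleftrightarrow>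
      Max ((\<lambda>i. U i \<omega> * X i \<omega>) ` {0..j - 1}) > c"
      using U_values
    proof eventually_elim
      case (elim \<omega>)
      have "c < U i \<omega> * X i \<omega> \<longleftrightarrow> U i \<omega> = 1 \<and> c < X i \<omega>" for i
        using elim[rule_format, of i] c by auto
      then show ?case by (subst Max_gr_iff) auto
    qed
  qed measurable
  finally show ?thesis .
qed

lemma prob_Y_T_exceeds:
  assumes c: "0 < c"
  shows "\<P>(\<omega> in M. Y T \<omega> > c) = \<P>(\<omega> in M. X 0 \<omega> > c)"
proof -
  have "\<P>(\<omega> in M. Y T \<omega> > c) = \<P>(\<omega> in M. X T \<omega> > c)"
  proof (rule prob_cong_AE)
    show "AE \<omega> in M. Y T \<omega> > c \<longleftrightarrow> X T \<omega> > c"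
      using U_0_T by eventually_elim (simp add: failure_seq_def)
  qed measurable
  then show ?thesis by (simp add: prob_X_eq[where j = T])
qed

text \<open>The set \<open>I\<close> collects the working indices in \<open>{T + 1..T + i}\<close>.
  Given \<open>I\<close>, the run end forces \<open>{i..T}\<close> to work and concerns
  \<open>X\<close> only at \<open>i\<close>, on \<open>{i + 1..T}\<close> and on \<open>I\<close>;
  failures in the second period reproduce values already required to be small.\<close>

lemma prob_Y_run_end_working:
  assumes c: "0 < c" and i: "1 \<le> i" "i < T"
  shows "\<P>(\<omega> in M. (Y i \<omega> > c \<and> (\<forall>m\<in>{i + 1..i + T}. Y m \<omega> \<le> c)) \<and> U i \<omega> = 1) =
    (\<Sum>I\<in>Pow (S_over T i). \<P>(\<omega> in M. X i \<omega> > c \<and> (\<forall>m\<in>S_mid T i \<union> I. X m \<omega> \<le> c)) *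
      (p ^ (card I + T - i) * (1 - p) ^ (i - card I)))"
    (is "\<P>(\<omega> in M. ?A \<omega>) = _")
proof -
  have "\<P>(\<omega> in M. ?A \<omega>) =
    (\<Sum>I\<in>Pow (S_over T i). \<P>(\<omega> in M. ?A \<omega> \<and> {j\<in>S_over T i. U j \<omega> = 1} = I))"
    by (rule prob_sum_U_pattern) (simp add: S_over_def, measurable)
  also have "\<dots> = (\<Sum>I\<in>Pow (S_over T i). \<P>(\<omega> in M. X i \<omega> > c \<and> (\<forall>m\<in>S_mid T i \<union> I. X m \<omega> \<le> c)) *
      (p ^ (card I + T - i) * (1 - p) ^ (i - card I)))"
  proof (rule sum.cong[OF refl])
    fix I assume "I \<in> Pow (S_over T i)"
    then have I: "I \<subseteq> {T + 1..T + i}" by (simp add: S_over_def)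
    let ?Q = "\<lambda>E. i \<in> E \<and> (\<forall>m\<in>{i + 1..T} \<union> I. m \<notin> E)"
    have QX: "?Q {j\<in>{0..T + i}. X j \<omega> > c} \<longleftrightarrow> X i \<omega> > c \<and> (\<forall>m\<in>{i + 1..T} \<union> I. X m \<omega> \<le> c)" for \<omega>
      using I by (auto simp: not_less)
    \<comment> \<open>Since the run end forces \<open>{i..T}\<close> to work, prescribing
      \<open>I\<close> amounts to prescribing the whole pattern on
      \<open>{i..T + i}\<close>.\<close>
    have "\<P>(\<omega> in M. ?A \<omega> \<and> {j\<in>S_over T i. U j \<omega> = 1} = I) =
      \<P>(\<omega> in M. ?Q {j\<in>{0..T + i}. X (0 * T + j) \<omega> > c} \<and> {j\<in>{i..T + i}. U (0 * T + j) \<omega> = 1} = {i..T} \<union> I)"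
    proof (rule prob_cong_AE)
      show "Measurable.pred M (\<lambda>\<omega>. ?A \<omega> \<and> {j\<in>S_over T i. U j \<omega> = 1} = I)"
        by (intro pred_intros_logic pred_finite_pattern[where Q = "\<lambda>E. E = I"]) (auto simp: S_over_def)
      show "Measurable.pred M (\<lambda>\<omega>. ?Q {j\<in>{0..T + i}. X (0 * T + j) \<omega> > c} \<and>
          {j\<in>{i..T + i}. U (0 * T + j) \<omega> = 1} = {i..T} \<union> I)"
        by (rule pred_XU_pattern[where R = "\<lambda>E V. ?Q E \<and> V = {i..T} \<union> I"]) auto
      show "AE \<omega> in M. (?A \<omega> \<and> {j\<in>S_over T i. U j \<omega> = 1} = I) \<longleftrightarrow>
        (?Q {j\<in>{0..T + i}. X (0 * T + j) \<omega> > c} \<and> {j\<in>{i..T + i}. U (0 * T + j) \<omega> = 1} = {i..T} \<union> I)"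
        using Y_exceeds[OF c] U_0_T
      proof eventually_elim
        case (elim \<omega>)
        let ?E = "{i. X i \<omega> > c}" and ?V = "{i. U i \<omega> = 1}"
        have "?A \<omega> \<longleftrightarrow> (failure_exceeds T ?E ?V i \<and> (\<forall>m\<in>{i + 1..i + T}. \<not> failure_exceeds T ?E ?V m)) \<and> i \<in> ?V"
          using elim(1) by (simp add: not_less[symmetric])
        also have "\<dots> \<longleftrightarrow> i \<in> ?V \<and> i \<in> ?E \<and> {i + 1..T} \<subseteq> ?V \<and> (\<forall>m\<in>{i + 1..T}. m \<notin> ?E) \<and>
          (\<forall>m\<in>{T + 1..T + i}. m \<in> ?V \<longrightarrow> m \<notin> ?E)"
          using elim(2) by (subst failure_run_end_iff[OF i]) auto
        finally have A: "?A \<omega> \<longleftrightarrow> i \<in> ?V \<and> i \<in> ?E \<and> {i + 1..T} \<subseteq> ?V \<and> (\<forall>m\<in>{i + 1..T}. m \<notin> ?E) \<and>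
          (\<forall>m\<in>{T + 1..T + i}. m \<in> ?V \<longrightarrow> m \<notin> ?E)" .
        have B: "{j\<in>{i..T + i}. U (0 * T + j) \<omega> = 1} = {i..T} \<union> I \<longleftrightarrow>
          i \<in> ?V \<and> {i + 1..T} \<subseteq> ?V \<and> {j\<in>{T + 1..T + i}. U j \<omega> = 1} = I"
          using working_pattern_iff[OF i I, of ?V] by simp
        have C: "?Q {j\<in>{0..T + i}. X (0 * T + j) \<omega> > c} \<longleftrightarrow>
          i \<in> ?E \<and> (\<forall>m\<in>{i + 1..T}. m \<notin> ?E) \<and> (\<forall>m\<in>I. m \<notin> ?E)"
          using QX[of \<omega>] by (auto simp: not_less)
        have D: "(\<forall>m\<in>{T + 1..T + i}. m \<in> ?V \<longrightarrow> m \<notin> ?E) \<longleftrightarrow> (\<forall>m\<in>I. m \<notin> ?E)"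
          if "{j\<in>{T + 1..T + i}. U j \<omega> = 1} = I"
          using that by blast
        show ?case unfolding A B C S_over_def using D by blast
      qed
    qed
    also have "\<dots> = \<P>(\<omega> in M. ?Q {j\<in>{0..T + i}. X j \<omega> > c}) * weight T p {i..T + i} ({i..T} \<union> I)"
      using i I by (intro prob_XU_pattern) auto
    also have "weight T p {i..T + i} ({i..T} \<union> I) = p ^ (card I + T - i) * (1 - p) ^ (i - card I)"
      by (rule weight_working_pattern[OF i I])
    also have "\<P>(\<omega> in M. ?Q {j\<in>{0..T + i}. X j \<omega> > c}) =
      \<P>(\<omega> in M. X i \<omega> > c \<and> (\<forall>m\<in>S_mid T i \<union> I. X m \<omega> \<le> c))"
      unfolding QX S_mid_def ..
    finally show "\<P>(\<omega> in M. ?A \<omega> \<and> {j\<in>S_over T i. U j \<omega> = 1} = I) =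
      \<P>(\<omega> in M. X i \<omega> > c \<and> (\<forall>m\<in>S_mid T i \<union> I. X m \<omega> \<le> c)) *
      (p ^ (card I + T - i) * (1 - p) ^ (i - card I))" .
  qed
  finally show ?thesis .
qed

text \<open>The exceedance at a failing \<open>i\<close> is a copy of one at an earlier working
  index, so the set \<open>J\<close> of working indices before \<open>i\<close> has to be summed
  over as well.\<close>

lemma prob_Y_run_end_failing:
  assumes c: "0 < c" and i: "1 \<le> i" "i < T"
  shows "\<P>(\<omega> in M. (Y i \<omega> > c \<and> (\<forall>m\<in>{i + 1..i + T}. Y m \<omega> \<le> c)) \<and> \<not> U i \<omega> = 1) =
    (\<Sum>J\<in>Pow (S_under i). \<Sum>I\<in>Pow (S_over T i).
      \<P>(\<omega> in M. (\<exists>m\<in>J \<union> {0}. X m \<omega> > c) \<and> (\<forall>m\<in>S_mid T i \<union> I. X m \<omega> \<le> c)) *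
      (p ^ (card I + card J + T - i - 1) * (1 - p) ^ (2 * i - card I - card J)))"
    (is "\<P>(\<omega> in M. ?A \<omega>) = _")
proof -
  have pred_under: "Measurable.pred M (\<lambda>\<omega>. ?A \<omega> \<and> {j\<in>S_under i. U j \<omega> = 1} = J)" for J
    by (intro pred_intros_logic pred_finite_pattern[where Q = "\<lambda>E. E = J"]) (auto simp: S_under_def)
  have "\<P>(\<omega> in M. ?A \<omega>) =
    (\<Sum>J\<in>Pow (S_under i). \<P>(\<omega> in M. ?A \<omega> \<and> {j\<in>S_under i. U j \<omega> = 1} = J))"
    by (rule prob_sum_U_pattern) (simp add: S_under_def, measurable)
  also have "\<dots> = (\<Sum>J\<in>Pow (S_under i). \<Sum>I\<in>Pow (S_over T i).
    \<P>(\<omega> in M. (?A \<omega> \<and> {j\<in>S_under i. U j \<omega> = 1} = J) \<and> {j\<in>S_over T i. U j \<omega> = 1} = I))"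
    by (intro sum.cong refl prob_sum_U_pattern pred_under) (simp add: S_over_def)
  also have "\<dots> = (\<Sum>J\<in>Pow (S_under i). \<Sum>I\<in>Pow (S_over T i).
      \<P>(\<omega> in M. (\<exists>m\<in>J \<union> {0}. X m \<omega> > c) \<and> (\<forall>m\<in>S_mid T i \<union> I. X m \<omega> \<le> c)) *
      (p ^ (card I + card J + T - i - 1) * (1 - p) ^ (2 * i - card I - card J)))"
  proof (intro sum.cong refl)
    fix I J assume "I \<in> Pow (S_over T i)" "J \<in> Pow (S_under i)"
    then have I: "I \<subseteq> {T + 1..T + i}" and J: "J \<subseteq> {1..i - 1}"
      by (simp_all add: S_over_def S_under_def)
    let ?Q = "\<lambda>E. (\<exists>m\<in>J \<union> {0}. m \<in> E) \<and> (\<forall>m\<in>{i + 1..T} \<union> I. m \<notin> E)"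
    let ?K = "(J \<union> {0}) \<union> ({i + 1..T} \<union> I)"
    have leJ: "m \<le> T + i" if "m \<in> J \<union> {0}" for m using that J i by fastforce
    have leI: "m \<le> T + i" if "m \<in> {i + 1..T} \<union> I" for m using that I by fastforce
    have QX: "?Q {j\<in>{0..T + i}. X j \<omega> > c} \<longleftrightarrow>
      (\<exists>m\<in>J \<union> {0}. X m \<omega> > c) \<and> (\<forall>m\<in>{i + 1..T} \<union> I. X m \<omega> \<le> c)" for \<omega>
    proof -
      have "(\<exists>m\<in>J \<union> {0}. m \<in> {j\<in>{0..T + i}. X j \<omega> > c}) \<longleftrightarrow> (\<exists>m\<in>J \<union> {0}. X m \<omega> > c)"
        by (rule bex_cong[OF refl]) (drule leJ, simp)
      moreover have "(\<forall>m\<in>{i + 1..T} \<union> I. m \<notin> {j\<in>{0..T + i}. X j \<omega> > c}) \<longleftrightarrow> (\<forall>m\<in>{i + 1..T} \<union> I. X m \<omega> \<le> c)"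
        by (rule ball_cong[OF refl]) (drule leI, simp add: not_less)
      ultimately show ?thesis by simp
    qed
    have "\<P>(\<omega> in M. (?A \<omega> \<and> {j\<in>S_under i. U j \<omega> = 1} = J) \<and> {j\<in>S_over T i. U j \<omega> = 1} = I) =
      \<P>(\<omega> in M. ?Q {j\<in>{0..T + i}. X (0 * T + j) \<omega> > c} \<and> {j\<in>{0..T + i}. U (0 * T + j) \<omega> = 1} = ?K)"
    proof (rule prob_cong_AE)
      show "Measurable.pred M (\<lambda>\<omega>. (?A \<omega> \<and> {j\<in>S_under i. U j \<omega> = 1} = J) \<and> {j\<in>S_over T i. U j \<omega> = 1} = I)"
        by (rule pred_intros_logic(3)[OF pred_under], rule pred_finite_pattern[where Q = "\<lambda>E. E = I"])
          (auto simp: S_over_def)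
      show "Measurable.pred M (\<lambda>\<omega>. ?Q {j\<in>{0..T + i}. X (0 * T + j) \<omega> > c} \<and>
          {j\<in>{0..T + i}. U (0 * T + j) \<omega> = 1} = ?K)"
        by (rule pred_XU_pattern[where R = "\<lambda>E V. ?Q E \<and> V = ?K"]) auto
      show "AE \<omega> in M. ((?A \<omega> \<and> {j\<in>S_under i. U j \<omega> = 1} = J) \<and> {j\<in>S_over T i. U j \<omega> = 1} = I) \<longleftrightarrow>
        (?Q {j\<in>{0..T + i}. X (0 * T + j) \<omega> > c} \<and> {j\<in>{0..T + i}. U (0 * T + j) \<omega> = 1} = ?K)"
        using Y_exceeds[OF c] U_0_T
      proof eventually_elim
        case (elim \<omega>)
        let ?E = "{i. X i \<omega> > c}" and ?V = "{i. U i \<omega> = 1}"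
        have "?A \<omega> \<longleftrightarrow> (failure_exceeds T ?E ?V i \<and> (\<forall>m\<in>{i + 1..i + T}. \<not> failure_exceeds T ?E ?V m)) \<and> i \<notin> ?V"
          using elim(1) by (simp add: not_less[symmetric])
        also have "\<dots> \<longleftrightarrow> i \<notin> ?V \<and> (\<exists>m\<in>{0..i - 1}. m \<in> ?V \<and> m \<in> ?E) \<and> {i + 1..T} \<subseteq> ?V \<and>
          (\<forall>m\<in>{i + 1..T}. m \<notin> ?E) \<and> (\<forall>m\<in>{T + 1..T + i}. m \<in> ?V \<longrightarrow> m \<notin> ?E)"
          using elim(2) by (subst failure_run_end_iff[OF i]) auto
        \<comment> \<open>Index 0 is split off because it works almost surely, whatever
          \<open>J\<close> is.\<close>
        also have "{0..i - 1} = {1..i - 1} \<union> {0}" by auto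
        finally have A: "?A \<omega> \<longleftrightarrow> i \<notin> ?V \<and> (\<exists>m\<in>{1..i - 1} \<union> {0}. m \<in> ?V \<and> m \<in> ?E) \<and> {i + 1..T} \<subseteq> ?V \<and>
          (\<forall>m\<in>{i + 1..T}. m \<notin> ?E) \<and> (\<forall>m\<in>{T + 1..T + i}. m \<in> ?V \<longrightarrow> m \<notin> ?E)" .
        have B: "{j\<in>{0..T + i}. U (0 * T + j) \<omega> = 1} = ?K \<longleftrightarrow>
          i \<notin> ?V \<and> {i + 1..T} \<subseteq> ?V \<and> {j\<in>{1..i - 1}. U j \<omega> = 1} = J \<and> {j\<in>{T + 1..T + i}. U j \<omega> = 1} = I"
          using failing_pattern_iff[OF i I J, of ?V] elim(2) by simp
        have C: "?Q {j\<in>{0..T + i}. X (0 * T + j) \<omega> > c} \<longleftrightarrow>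
          (\<exists>m\<in>J \<union> {0}. m \<in> ?E) \<and> (\<forall>m\<in>{i + 1..T}. m \<notin> ?E) \<and> (\<forall>m\<in>I. m \<notin> ?E)"
          using QX[of \<omega>] by (auto simp: not_less)
        have D: "(\<forall>m\<in>{T + 1..T + i}. m \<in> ?V \<longrightarrow> m \<notin> ?E) \<longleftrightarrow> (\<forall>m\<in>I. m \<notin> ?E)"
          if "{j\<in>{T + 1..T + i}. U j \<omega> = 1} = I"
          using that by blast
        have "0 \<in> ?V" using elim(2) by simp
        then have F: "(\<exists>m\<in>{1..i - 1} \<union> {0}. m \<in> ?V \<and> m \<in> ?E) \<longleftrightarrow> (\<exists>m\<in>J \<union> {0}. m \<in> ?E)"
          if "{j\<in>{1..i - 1}. U j \<omega> = 1} = J"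
          using that by blast
        show ?case unfolding A B C S_over_def S_under_def using D F by blast
      qed
    qed
    also have "\<dots> = \<P>(\<omega> in M. ?Q {j\<in>{0..T + i}. X j \<omega> > c}) * weight T p {0..T + i} ?K"
      using I J i by (intro prob_XU_pattern) fastforce+
    also have "weight T p {0..T + i} ?K = p ^ (card I + card J + T - i - 1) * (1 - p) ^ (2 * i - card I - card J)"
      by (rule weight_failing_pattern[OF i I J])
    also have "\<P>(\<omega> in M. ?Q {j\<in>{0..T + i}. X j \<omega> > c}) =
      \<P>(\<omega> in M. (\<exists>m\<in>J \<union> {0}. X m \<omega> > c) \<and> (\<forall>m\<in>S_mid T i \<union> I. X m \<omega> \<le> c))"
      unfolding QX S_mid_def ..
    finally show "\<P>(\<omega> in M. (?A \<omega> \<and> {j\<in>S_under i. U j \<omega> = 1} = J) \<and> {j\<in>S_over T i. U j \<omega> = 1} = I) =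
      \<P>(\<omega> in M. (\<exists>m\<in>J \<union> {0}. X m \<omega> > c) \<and> (\<forall>m\<in>S_mid T i \<union> I. X m \<omega> \<le> c)) *
      (p ^ (card I + card J + T - i - 1) * (1 - p) ^ (2 * i - card I - card J))" .
  qed
  finally show ?thesis .
qed

text \<open>The event lives on \<open>{T..2 * T}\<close>, so patterns are taken with the shift
  \<open>q = 1\<close>. Relative to it, 0 and \<open>T\<close> have weight 1 and the
  \<open>T - 1\<close> indices between them have to work.\<close>

lemma prob_Y_run_end_T:
  assumes c: "0 < c"
  shows "\<P>(\<omega> in M. Y T \<omega> > c \<and> (\<forall>m\<in>{T + 1..T + T}. Y m \<omega> \<le> c)) =
    p ^ (T - 1) * \<P>(\<omega> in M. X 0 \<omega> > c \<and> (\<forall>m\<in>{1..T}. X m \<omega> \<le> c))"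
proof -
  let ?Q = "\<lambda>E. 0 \<in> E \<and> (\<forall>m\<in>{1..T}. m \<notin> E)"
  have "\<P>(\<omega> in M. Y T \<omega> > c \<and> (\<forall>m\<in>{T + 1..T + T}. Y m \<omega> \<le> c)) =
    \<P>(\<omega> in M. ?Q {j\<in>{0..T}. X (1 * T + j) \<omega> > c} \<and> {j\<in>{0..T}. U (1 * T + j) \<omega> = 1} = {0..T})"
  proof (rule prob_cong_AE)
    show "Measurable.pred M (\<lambda>\<omega>. ?Q {j\<in>{0..T}. X (1 * T + j) \<omega> > c} \<and> {j\<in>{0..T}. U (1 * T + j) \<omega> = 1} = {0..T})"
      by (rule pred_XU_pattern[where R = "\<lambda>E V. ?Q E \<and> V = {0..T}"]) auto
    show "AE \<omega> in M. (Y T \<omega> > c \<and> (\<forall>m\<in>{T + 1..T + T}. Y m \<omega> \<le> c)) \<longleftrightarrow>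
      (?Q {j\<in>{0..T}. X (1 * T + j) \<omega> > c} \<and> {j\<in>{0..T}. U (1 * T + j) \<omega> = 1} = {0..T})"
      using Y_exceeds[OF c] U_0_T
    proof eventually_elim
      case (elim \<omega>)
      let ?E = "{i. X i \<omega> > c}" and ?V = "{i. U i \<omega> = 1}"
      have "Y T \<omega> > c \<and> (\<forall>m\<in>{T + 1..T + T}. Y m \<omega> \<le> c) \<longleftrightarrow>
        failure_exceeds T ?E ?V T \<and> (\<forall>m\<in>{T + 1..T + T}. \<not> failure_exceeds T ?E ?V m)"
        using elim(1) by (simp add: not_less[symmetric])
      also have "\<dots> \<longleftrightarrow> T \<in> ?E \<and> {T..T + T} \<subseteq> ?V \<and> (\<forall>m\<in>{T + 1..T + T}. m \<notin> ?E)"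
        using elim(2) by (intro failure_run_end_T_iff T_pos) auto
      also have "{T..T + T} \<subseteq> ?V \<longleftrightarrow> {j\<in>{0..T}. U (1 * T + j) \<omega> = 1} = {0..T}"
        using ball_shift[of T 0 T "\<lambda>m. U m \<omega> = 1"] by (auto simp: subset_eq)
      also have "(\<forall>m\<in>{T + 1..T + T}. m \<notin> ?E) \<longleftrightarrow> (\<forall>m\<in>{1..T}. T + m \<notin> ?E)"
        by (rule ball_shift)
      finally show ?case by auto
    qed
  qed measurable
  also have "\<dots> = \<P>(\<omega> in M. ?Q {j\<in>{0..T}. X j \<omega> > c}) * weight T p {0..T} {0..T}"
    by (rule prob_XU_pattern) auto
  also have "weight T p {0..T} {0..T} = p ^ (T - 1)"
  proof -
    have "{0..T} = insert 0 (insert T {1..T - 1})" using T_pos by auto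
    then have "weight T p {0..T} {0..T} = weight T p {1..T - 1} {0..T}"
      using T_pos by (simp only:, subst weight_insert, simp, simp, subst weight_insert) auto
    also have "\<dots> = p ^ (T - 1)"
      by (subst weight_non_multiples) (auto dest: dvd_imp_le simp: Int_absorb2)
    finally show ?thesis .
  qed
  also have "\<P>(\<omega> in M. ?Q {j\<in>{0..T}. X j \<omega> > c}) = \<P>(\<omega> in M. X 0 \<omega> > c \<and> (\<forall>m\<in>{1..T}. X m \<omega> \<le> c))"
    by (intro arg_cong[where f = prob] Collect_cong) (auto simp: not_less)
  finally show ?thesis by simp
qed

section \<open>Returns after a run of \<open>T\<close> non-exceedances\<close>

lemma prob_clump_shift:
  assumes "finite A" "finite B"
  shows "\<P>(\<omega> in M. (\<exists>j\<in>A. X (h + j) \<omega> > c) \<and> X (h + i) \<omega> \<le> c \<and> (\<exists>j\<in>B. X (h + j) \<omega> > c)) =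
    \<P>(\<omega> in M. (\<exists>j\<in>A. X j \<omega> > c) \<and> X i \<omega> \<le> c \<and> (\<exists>j\<in>B. X j \<omega> > c))"
proof -
  let ?J = "A \<union> {i} \<union> B" and ?Q = "\<lambda>E. (\<exists>j\<in>A. j \<in> E) \<and> i \<notin> E \<and> (\<exists>j\<in>B. j \<in> E)"
  have "\<P>(\<omega> in M. (\<exists>j\<in>A. X (h + j) \<omega> > c) \<and> X (h + i) \<omega> \<le> c \<and> (\<exists>j\<in>B. X (h + j) \<omega> > c)) =
    \<P>(\<omega> in M. ?Q {j\<in>?J. X (h + j) \<omega> > c})" for h
    by (intro arg_cong[where f = prob] Collect_cong) (auto simp: not_less)
  from this[of h] this[of 0] show ?thesis
    using prob_X_pattern[where J = ?J and h = h and Q = ?Q and c = c] assms by simp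
qed

text \<open>The probability in the local dependence condition.\<close>

definition clump :: "real \<Rightarrow> nat \<Rightarrow> real" where
  "clump c r = \<P>(\<omega> in M. (\<exists>j\<in>{0..T}. X j \<omega> > c) \<and> X (T + 1) \<omega> \<le> c \<and> (\<exists>j\<in>{T + 2..r + T}. X j \<omega> > c))"

lemma clump_shift:
  "clump c r = \<P>(\<omega> in M. (\<exists>j\<in>{h..h + T}. X j \<omega> > c) \<and> X (h + T + 1) \<omega> \<le> c \<and>
     (\<exists>j\<in>{h + T + 2..h + r + T}. X j \<omega> > c))"
proof -
  have "(\<exists>j\<in>{h..h + T}. X j \<omega> > c) \<longleftrightarrow> (\<exists>j\<in>{0..T}. X (h + j) \<omega> > c)" for \<omega>
    using ball_shift[of h 0 T "\<lambda>j. X j \<omega> \<le> c"] by (auto simp: not_le[symmetric] simp del: not_le)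
  moreover have "(\<exists>j\<in>{h + T + 2..h + r + T}. X j \<omega> > c) \<longleftrightarrow> (\<exists>j\<in>{T + 2..r + T}. X (h + j) \<omega> > c)" for \<omega>
    using ball_shift[of h "T + 2" "r + T" "\<lambda>j. X j \<omega> \<le> c"]
    by (auto simp: not_le[symmetric] add.assoc simp del: not_le)
  ultimately show ?thesis
    unfolding clump_def using prob_clump_shift[where A = "{0..T}" and B = "{T + 2..r + T}" and h = h and c = c and i = "T + 1"]
    by (simp add: add.assoc)
qed

text \<open>Of the \<open>T\<close> non-exceedances only the one at \<open>j + 1\<close> is kept. A
  shift by \<open>T\<close> moves \<open>j\<close> to the end of the window
  \<open>{j..j + T}\<close>, so that the non-exceedance directly follows the window, as in
  \<open>clump\<close>.\<close>

lemma X_return_le_clump: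
  "\<P>(\<omega> in M. X j \<omega> > c \<and> (\<forall>i\<in>{j + 1..j + T}. X i \<omega> \<le> c) \<and> (\<exists>i\<in>{j + T + 1..r}. X i \<omega> > c)) \<le> clump c r"
proof -
  have "\<P>(\<omega> in M. X j \<omega> > c \<and> (\<forall>i\<in>{j + 1..j + T}. X i \<omega> \<le> c) \<and> (\<exists>i\<in>{j + T + 1..r}. X i \<omega> > c)) \<le>
    \<P>(\<omega> in M. (\<exists>i\<in>{j}. X i \<omega> > c) \<and> X (j + 1) \<omega> \<le> c \<and> (\<exists>i\<in>{j + 2..r}. X i \<omega> > c))"
    using T_ge by (intro finite_measure_mono) auto
  also have "\<dots> = \<P>(\<omega> in M. (\<exists>i\<in>{j}. X (T + i) \<omega> > c) \<and> X (T + (j + 1)) \<omega> \<le> c \<and> (\<exists>i\<in>{j + 2..r}. X (T + i) \<omega> > c))"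
    by (rule prob_clump_shift[symmetric]) auto
  also have "\<dots> \<le> \<P>(\<omega> in M. (\<exists>i\<in>{j..j + T}. X i \<omega> > c) \<and> X (j + T + 1) \<omega> \<le> c \<and>
     (\<exists>i\<in>{j + T + 2..j + r + T}. X i \<omega> > c))"
  proof (intro finite_measure_mono subsetI)
    fix \<omega> assume \<omega>: "\<omega> \<in> {\<omega>\<in>space M. (\<exists>i\<in>{j}. X (T + i) \<omega> > c) \<and> X (T + (j + 1)) \<omega> \<le> c \<and> (\<exists>i\<in>{j + 2..r}. X (T + i) \<omega> > c)}"
    then obtain i where "j + 2 \<le> i" "i \<le> r" "X (T + i) \<omega> > c" by auto
    then have "\<exists>i\<in>{j + T + 2..j + r + T}. X i \<omega> > c" by (intro bexI[of _ "T + i"]) auto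
    moreover have "\<exists>i\<in>{j..j + T}. X i \<omega> > c" using \<omega> by (intro bexI[of _ "T + j"]) auto
    moreover have "X (j + T + 1) \<omega> \<le> c" using \<omega> by (simp add: algebra_simps)
    ultimately show "\<omega> \<in> {\<omega>\<in>space M. (\<exists>i\<in>{j..j + T}. X i \<omega> > c) \<and> X (j + T + 1) \<omega> \<le> c \<and>
     (\<exists>i\<in>{j + T + 2..j + r + T}. X i \<omega> > c)}" using \<omega> by blast
  qed measurable
  also have "\<dots> = clump c r" by (rule clump_shift[symmetric])
  finally show ?thesis .
qed

text \<open>By \<open>failure_separated_exceedances\<close> a return of \<open>Y\<close> forces
  exceedances of \<open>X\<close> on both sides of a non-exceedance at the next multiple of
  \<open>T\<close> after \<open>j\<close>.\<close>

lemma Y_return_le_clump: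
  assumes c: "0 < c"
  shows "\<P>(\<omega> in M. Y j \<omega> > c \<and> (\<forall>i\<in>{j + 1..j + T}. Y i \<omega> \<le> c) \<and> (\<exists>i\<in>{j + T + 1..r}. Y i \<omega> > c)) \<le> clump c r"
proof -
  define b where "b = j div T * T"
  have "\<P>(\<omega> in M. Y j \<omega> > c \<and> (\<forall>i\<in>{j + 1..j + T}. Y i \<omega> \<le> c) \<and> (\<exists>i\<in>{j + T + 1..r}. Y i \<omega> > c)) \<le>
    \<P>(\<omega> in M. (\<exists>i\<in>{b..b + T - 1}. X i \<omega> > c) \<and> X (b + T) \<omega> \<le> c \<and> (\<exists>i\<in>{b + T + 1..r}. X i \<omega> > c))"
  proof (rule finite_measure_mono_AE)
    show "AE \<omega> in M. \<omega> \<in> {\<omega>\<in>space M. Y j \<omega> > c \<and> (\<forall>i\<in>{j + 1..j + T}. Y i \<omega> \<le> c) \<and> (\<exists>i\<in>{j + T + 1..r}. Y i \<omega> > c)} \<longrightarrow>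
      \<omega> \<in> {\<omega>\<in>space M. (\<exists>i\<in>{b..b + T - 1}. X i \<omega> > c) \<and> X (b + T) \<omega> \<le> c \<and> (\<exists>i\<in>{b + T + 1..r}. X i \<omega> > c)}"
      using Y_exceeds[OF c] U_multiples
    proof eventually_elim
      case (elim \<omega>)
      let ?E = "{i. X i \<omega> > c}" and ?V = "{i. U i \<omega> = 1}"
      show ?case
      proof
        assume \<omega>: "\<omega> \<in> {\<omega>\<in>space M. Y j \<omega> > c \<and> (\<forall>i\<in>{j + 1..j + T}. Y i \<omega> \<le> c) \<and> (\<exists>i\<in>{j + T + 1..r}. Y i \<omega> > c)}"
        then obtain i where i: "j + T + 1 \<le> i" "i \<le> r" "Y i \<omega> > c" by auto
        have 1: "m * T \<in> ?V" for m using elim(2) by simp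
        have 2: "failure_exceeds T ?E ?V j" "failure_exceeds T ?E ?V i" using elim(1) \<omega> i by auto
        have 3: "\<forall>i\<in>{j + 1..j + T}. \<not> failure_exceeds T ?E ?V i"
          using \<omega> by (simp add: elim(1)[rule_format, symmetric] not_less)
        note sep = failure_separated_exceedances[OF T_pos 1 2(1) 3 2(2) i(1), folded b_def]
        have "\<exists>m\<in>{b + T + 1..r}. X m \<omega> > c" using sep(3) i(2) by force
        with sep(1,2) \<omega> show "\<omega> \<in> {\<omega>\<in>space M. (\<exists>i\<in>{b..b + T - 1}. X i \<omega> > c) \<and> X (b + T) \<omega> \<le> c \<and> (\<exists>i\<in>{b + T + 1..r}. X i \<omega> > c)}"
          by (auto simp: not_less)
      qed
    qed
  qed measurable
  \<comment> \<open>A shift by 1 moves \<open>{b..b + T - 1}\<close> into \<open>{b..b + T}\<close>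
    and the non-exceedance to \<open>b + T + 1\<close>, the position required by
    \<open>clump_shift\<close> with \<open>h = b\<close>.\<close>
  also have "\<dots> = \<P>(\<omega> in M. (\<exists>i\<in>{b..b + T - 1}. X (1 + i) \<omega> > c) \<and> X (1 + (b + T)) \<omega> \<le> c \<and> (\<exists>i\<in>{b + T + 1..r}. X (1 + i) \<omega> > c))"
    by (rule prob_clump_shift[symmetric]) auto
  also have "\<dots> \<le> \<P>(\<omega> in M. (\<exists>i\<in>{b..b + T}. X i \<omega> > c) \<and> X (b + T + 1) \<omega> \<le> c \<and>
     (\<exists>i\<in>{b + T + 2..b + r + T}. X i \<omega> > c))"
  proof (intro finite_measure_mono subsetI)
    fix \<omega> assume \<omega>: "\<omega> \<in> {\<omega>\<in>space M. (\<exists>i\<in>{b..b + T - 1}. X (1 + i) \<omega> > c) \<and> X (1 + (b + T)) \<omega> \<le> c \<and> (\<exists>i\<in>{b + T + 1..r}. X (1 + i) \<omega> > c)}"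
    then obtain i i' where "b + T + 1 \<le> i" "i \<le> r" "X (1 + i) \<omega> > c"
      and i': "b \<le> i'" "i' \<le> b + T - 1" "X (1 + i') \<omega> > c" by auto
    then have "\<exists>i\<in>{b + T + 2..b + r + T}. X i \<omega> > c" using T_ge by (intro bexI[of _ "1 + i"]) auto
    moreover have "\<exists>i\<in>{b..b + T}. X i \<omega> > c" using i' T_ge by (intro bexI[of _ "1 + i'"]) auto
    moreover have "X (b + T + 1) \<omega> \<le> c" using \<omega> by simp
    ultimately show "\<omega> \<in> {\<omega>\<in>space M. (\<exists>i\<in>{b..b + T}. X i \<omega> > c) \<and> X (b + T + 1) \<omega> \<le> c \<and>
     (\<exists>i\<in>{b + T + 2..b + r + T}. X i \<omega> > c)}" using \<omega> by blast
  qed measurable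
  also have "\<dots> = clump c r" by (rule clump_shift[symmetric])
  finally show ?thesis .
qed

text \<open>An exceedance of \<open>Y j\<close> needs one of \<open>X\<close> at \<open>j\<close> or
  in the look-back window, hence in a set of at most \<open>T + 1\<close> indices.\<close>

lemma prob_Y_exceeds_le:
  assumes "0 < c"
  shows "\<P>(\<omega> in M. Y j \<omega> > c) \<le> real (T + 1) * \<P>(\<omega> in M. X 0 \<omega> > c)"
proof -
  let ?I = "{(j - 1) div T * T..j}"
  have "\<P>(\<omega> in M. Y j \<omega> > c) \<le> \<P>(\<omega> in M. \<exists>i\<in>?I. X i \<omega> > c)"
  proof (rule finite_measure_mono_AE)
    have le: "(j - 1) div T * T \<le> j" by (metis div_times_less_eq_dividend diff_le_self le_trans)
    show "AE \<omega> in M. \<omega> \<in> {\<omega>\<in>space M. Y j \<omega> > c} \<longrightarrow> \<omega> \<in> {\<omega>\<in>space M. \<exists>i\<in>?I. X i \<omega> > c}"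
      using Y_exceeds[OF assms]
    proof eventually_elim
      case (elim \<omega>)
      show ?case
      proof
        assume \<omega>: "\<omega> \<in> {\<omega>\<in>space M. Y j \<omega> > c}"
        then have "failure_exceeds T {i. X i \<omega> > c} {i. U i \<omega> = 1} j" using elim by simp
        then have "\<exists>i\<in>?I. X i \<omega> > c"
          using le by (auto simp: failure_exceeds_def split: if_splits) (meson atLeastAtMost_iff diff_le_self le_trans)
        with \<omega> show "\<omega> \<in> {\<omega>\<in>space M. \<exists>i\<in>?I. X i \<omega> > c}" by simp
      qed
    qed
  qed measurable
  also have "\<dots> \<le> (\<Sum>i\<in>?I. \<P>(\<omega> in M. X i \<omega> > c))"
    by (rule prob_Ex_le_sum) auto
  also have "\<dots> = real (card ?I) * \<P>(\<omega> in M. X 0 \<omega> > c)"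
    by (subst prob_X_eq) simp
  also have "\<dots> \<le> real (T + 1) * \<P>(\<omega> in M. X 0 \<omega> > c)"
  proof (intro mult_right_mono of_nat_mono)
    have "j - 1 < (j - 1) div T * T + T"
      by (metis T_pos add.commute dividend_less_div_times)
    then show "card ?I \<le> T + 1" by simp
  qed simp
  finally show ?thesis .
qed

text \<open>If \<open>l_n = 0\<close>, the bound on \<open>k_n l_n / n\<close> says nothing about \<open>k_n / n\<close>. But then overlapping
  intervals are admitted in the mixing coefficient, which is therefore at least of order \<open>1/n\<close>.\<close>

lemma mixing_coeff_0_ge:
  assumes "3 \<le> n"
  shows "\<P>(\<omega> in M. X 0 \<omega> > u n) - 4 * (\<P>(\<omega> in M. X 0 \<omega> > u n))\<^sup>2 \<le> mixing_coeff M X u n 0"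
proof -
  define t where "t = \<P>(\<omega> in M. X 0 \<omega> > u n)"
  define x where "x = \<P>(\<omega> in M. \<forall>m\<in>{1..2}. X m \<omega> \<le> u n)"
  define y where "y = \<P>(\<omega> in M. \<forall>m\<in>{2..3}. X m \<omega> \<le> u n)"
  define z where "z = \<P>(\<omega> in M. (\<forall>m\<in>{1..2}. X m \<omega> \<le> u n) \<and> (\<forall>m\<in>{2..3}. X m \<omega> \<le> u n))"
  have ge: "1 - \<P>(\<omega> in M. \<forall>m\<in>{i..i + 1}. X m \<omega> \<le> u n) \<le> 2 * t" for i
  proof -
    have "1 - \<P>(\<omega> in M. \<forall>m\<in>{i..i + 1}. X m \<omega> \<le> u n) = \<P>(\<omega> in M. \<not> (\<forall>m\<in>{i..i + 1}. X m \<omega> \<le> u n))"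
      by (rule prob_neg[symmetric]) measurable
    also have "\<dots> \<le> (\<Sum>m\<in>{i..i + 1}. \<P>(\<omega> in M. X m \<omega> > u n))"
      by (rule prob_Ex_le_sum) (auto simp: not_le)
    also have "\<dots> = 2 * t" unfolding t_def by (subst prob_X_eq) simp
    finally show ?thesis .
  qed
  have eq: "{1..1 + 1} = {1..2::nat}" "{2..2 + 1} = {2..3::nat}"
    by (simp_all add: numeral_2_eq_2 numeral_3_eq_3)
  have xy: "1 - x \<le> 2 * t" "1 - y \<le> 2 * t" using ge[of 1] ge[of 2] unfolding x_def y_def eq .
  have xy': "0 \<le> 1 - x" "0 \<le> 1 - y" by (simp_all add: x_def y_def)
  \<comment> \<open>Both events imply \<open>X 2 \<le> u n\<close>, so
    \<open>x + y - z \<le> 1 - t\<close>. Hence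
    \<open>z - x * y \<ge> t - (1 - x) * (1 - y)\<close>, where both factors are at most
    \<open>2 * t\<close>.\<close>
  have "x + y - z = \<P>(\<omega> in M. (\<forall>m\<in>{1..2}. X m \<omega> \<le> u n) \<or> (\<forall>m\<in>{2..3}. X m \<omega> \<le> u n))"
  proof -
    have "\<P>(\<omega> in M. (\<forall>m\<in>{1..2}. X m \<omega> \<le> u n) \<or> (\<forall>m\<in>{2..3}. X m \<omega> \<le> u n)) =
      prob ({\<omega>\<in>space M. \<forall>m\<in>{1..2}. X m \<omega> \<le> u n} \<union> {\<omega>\<in>space M. \<forall>m\<in>{2..3}. X m \<omega> \<le> u n})"
      by (intro arg_cong[where f = prob]) auto
    also have "\<dots> = x + y - prob ({\<omega>\<in>space M. \<forall>m\<in>{1..2}. X m \<omega> \<le> u n} \<inter> {\<omega>\<in>space M. \<forall>m\<in>{2..3}. X m \<omega> \<le> u n})"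
      unfolding x_def y_def by (rule measure_Un3) (simp_all add: fmeasurable_eq_sets)
    also have "{\<omega>\<in>space M. \<forall>m\<in>{1..2}. X m \<omega> \<le> u n} \<inter> {\<omega>\<in>space M. \<forall>m\<in>{2..3}. X m \<omega> \<le> u n} =
      {\<omega>\<in>space M. (\<forall>m\<in>{1..2}. X m \<omega> \<le> u n) \<and> (\<forall>m\<in>{2..3}. X m \<omega> \<le> u n)}" by auto
    finally show ?thesis by (simp add: z_def)
  qed
  also have "\<dots> \<le> \<P>(\<omega> in M. \<not> X 2 \<omega> > u n)"
    by (intro finite_measure_mono) (auto simp: not_less)
  also have "\<dots> = 1 - t"
    unfolding t_def prob_X_eq[where j = 2, symmetric] by (rule prob_neg) measurable
  finally have z: "x + y - 1 + t \<le> z" by simp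
  \<comment> \<open>With gap 0 the intervals \<open>{1..2}\<close> and \<open>{2..3}\<close>, which
    share index 2, are admissible.\<close>
  have "\<bar>z - x * y\<bar> \<le> mixing_coeff M X u n 0"
    using mixing_coeff_ge[of 1 1 0 2 1 n X u, unfolded eq] assms by (simp add: x_def y_def z_def)
  moreover have "(1 - x) * (1 - y) \<le> (2 * t) * (2 * t)"
    using xy xy' by (intro mult_mono) auto
  ultimately show ?thesis
    using z unfolding t_def[symmetric] by (simp add: algebra_simps power2_eq_square)
qed

lemma run_end_Y_P_seq:
  assumes u: "0 < u n" and i: "1 \<le> i" "i < T"
  shows "real n * \<P>(\<omega> in M. Y i \<omega> > u n \<and> (\<forall>m\<in>{i + 1..i + T}. Y m \<omega> \<le> u n)) =
    P_seq1 M X u p T i n + P_seq2 M X u p T i n +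
    p ^ T * (real n * \<P>(\<omega> in M. X 0 \<omega> > u n \<and> (\<forall>m\<in>{1..T}. X m \<omega> \<le> u n)))"
proof -
  let ?A = "\<lambda>\<omega>. Y i \<omega> > u n \<and> (\<forall>m\<in>{i + 1..i + T}. Y m \<omega> \<le> u n)"
  let ?f = "\<lambda>I. \<P>(\<omega> in M. X i \<omega> > u n \<and> (\<forall>m\<in>S_mid T i \<union> I. X m \<omega> \<le> u n)) *
      (p ^ (card I + T - i) * (1 - p) ^ (i - card I))"
  let ?q = "\<P>(\<omega> in M. X 0 \<omega> > u n \<and> (\<forall>m\<in>{1..T}. X m \<omega> \<le> u n))"
  have fin: "finite (S_over T i)" and cs: "card (S_over T i) = i" by (simp_all add: S_over_def)
  have "\<P>(\<omega> in M. ?A \<omega>) = \<P>(\<omega> in M. ?A \<omega> \<and> U i \<omega> = 1) + \<P>(\<omega> in M. ?A \<omega> \<and> \<not> U i \<omega> = 1)"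
    by (rule prob_conj_not) measurable
  moreover have "real n * \<P>(\<omega> in M. ?A \<omega> \<and> \<not> U i \<omega> = 1) = P_seq2 M X u p T i n"
    unfolding prob_Y_run_end_failing[OF u i] P_seq2_def seq_max_le_iff less_seq_max_iff
    by (simp only: mult.assoc)
  moreover have "\<P>(\<omega> in M. ?A \<omega> \<and> U i \<omega> = 1) = (\<Sum>I\<in>Pow (S_over T i). ?f I)"
    by (rule prob_Y_run_end_working[OF u i])
  moreover have "Pow (S_over T i) = insert (S_over T i) {I. I \<subset> S_over T i}" by auto
  moreover have "(\<Sum>I\<in>insert (S_over T i) {I. I \<subset> S_over T i}. ?f I) =
      ?f (S_over T i) + (\<Sum>I\<in>{I. I \<subset> S_over T i}. ?f I)"
    using fin by (intro sum.insert) (auto intro: finite_subset[of _ "Pow (S_over T i)"])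
  moreover have "real n * (\<Sum>I\<in>{I. I \<subset> S_over T i}. ?f I) = P_seq1 M X u p T i n"
    unfolding P_seq1_def seq_max_le_iff by (simp only: mult.assoc)
  \<comment> \<open>The full set has \<open>card I = i\<close>, so its weight is
    \<open>p ^ T\<close>. Its event is \<open>X i > u n\<close> followed by \<open>T\<close>
    non-exceedances, and stationarity moves it to index 0.\<close>
  moreover have "?f (S_over T i) = p ^ T * ?q"
  proof -
    let ?Q = "\<lambda>E. 0 \<in> E \<and> (\<forall>m\<in>{1..T}. m \<notin> E)"
    have "S_mid T i \<union> S_over T i = {i + 1..i + T}" using i by (auto simp: S_mid_def S_over_def)
    then have "\<P>(\<omega> in M. X i \<omega> > u n \<and> (\<forall>m\<in>S_mid T i \<union> S_over T i. X m \<omega> \<le> u n)) =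
      \<P>(\<omega> in M. ?Q {j\<in>{0..T}. X (i + j) \<omega> > u n})"
      by (simp only: ball_shift) (intro arg_cong[where f = prob] Collect_cong, auto simp: not_less)
    also have "\<dots> = \<P>(\<omega> in M. ?Q {j\<in>{0..T}. X j \<omega> > u n})"
      by (rule prob_X_pattern) simp
    also have "\<dots> = ?q"
      by (intro arg_cong[where f = prob] Collect_cong) (auto simp: not_less)
    finally show ?thesis unfolding cs by simp
  qed
  ultimately show ?thesis by (simp only: distrib_left) (simp add: algebra_simps)
qed

end

section \<open>The extremal index\<close>

lemma (in prob_space) one_minus_cdf:
  assumes [measurable]: "f \<in> borel_measurable M"
  shows "1 - cdf (distr M borel f) c = \<P>(\<omega> in M. f \<omega> > c)"
proof -
  have "cdf (distr M borel f) c = \<P>(\<omega> in M. f \<omega> \<le> c)"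
    unfolding cdf_def2 by (subst measure_distr) (auto intro!: arg_cong[where f = prob])
  moreover have "\<P>(\<omega> in M. \<not> f \<omega> \<le> c) = 1 - \<P>(\<omega> in M. f \<omega> \<le> c)"
    by (rule prob_neg) measurable
  ultimately show ?thesis by (simp add: not_le)
qed

lemma (in prob_space) has_extremal_index_iff:
  assumes "\<tau> \<noteq> 0"
  shows "has_extremal_index M W u \<tau> \<theta> \<longleftrightarrow>
    (\<lambda>n. \<P>(\<omega> in M. \<forall>j\<in>{1..n}. W j \<omega> \<le> u n)) \<longlonglongrightarrow> exp (- (\<tau> * \<theta>))"
proof
  assume "has_extremal_index M W u \<tau> \<theta>"
  then obtain L where L: "L > 0" "\<theta> = - (1 / \<tau>) * ln L"
    and lim: "(\<lambda>n. \<P>(\<omega> in M. \<forall>j\<in>{1..n}. W j \<omega> \<le> u n)) \<longlonglongrightarrow> L"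
    by (auto simp: has_extremal_index_def seq_max_le_iff)
  have "exp (- (\<tau> * \<theta>)) = L" using L assms by simp
  with lim show "(\<lambda>n. \<P>(\<omega> in M. \<forall>j\<in>{1..n}. W j \<omega> \<le> u n)) \<longlonglongrightarrow> exp (- (\<tau> * \<theta>))" by simp
next
  assume "(\<lambda>n. \<P>(\<omega> in M. \<forall>j\<in>{1..n}. W j \<omega> \<le> u n)) \<longlonglongrightarrow> exp (- (\<tau> * \<theta>))"
  then show "has_extremal_index M W u \<tau> \<theta>"
    using assms unfolding has_extremal_index_def seq_max_le_iff
    by (intro exI[of _ "exp (- (\<tau> * \<theta>))"]) auto
qed

section \<open>Smallness of \<open>k n / n\<close>, the value of \<tau> and the limit for
  \<open>Y\<close>\<close>

context failure_model
begin

text \<open>If \<open>l n \<ge> 1\<close>, then \<open>k n / n \<le> k n * l n / n\<close>. If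
  \<open>l n = 0\<close> and \<open>n\<close> is large, the mixing coefficient is at least
  \<open>t - 4 t^2 \<ge> t / 2 \<ge> \<tau> / (4 n)\<close>, where \<open>t\<close> is the
  exceedance probability of \<open>X 0\<close>. The bounds are added because both cases may occur
  infinitely often.\<close>

lemma k_over_n_tendsto_0:
  assumes \<tau>: "(\<lambda>n. real n * \<P>(\<omega> in M. X 0 \<omega> > u n)) \<longlonglongrightarrow> \<tau>" "0 < \<tau>"
    and kl: "(\<lambda>n. real (k n) * real (l n) / real n) \<longlonglongrightarrow> 0"
    and mix: "(\<lambda>n. real (k n) * mixing_coeff M X u n (l n)) \<longlonglongrightarrow> 0"
  shows "(\<lambda>n. real (k n) / real n) \<longlonglongrightarrow> 0"
proof (rule Lim_null_comparison)
  let ?t = "\<lambda>n. \<P>(\<omega> in M. X 0 \<omega> > u n)"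
  let ?b = "\<lambda>n. real (k n) * real (l n) / real n + 4 / \<tau> * \<bar>real (k n) * mixing_coeff M X u n (l n)\<bar>"
  have "\<forall>\<^sub>F n in sequentially. \<tau> / 2 < real n * ?t n" "\<forall>\<^sub>F n in sequentially. real n * ?t n < 2 * \<tau>"
    using order_tendstoD[OF \<tau>(1), of "\<tau> / 2"] order_tendstoD[OF \<tau>(1), of "2 * \<tau>"] \<tau>(2) by auto
  \<comment> \<open>Together with \<open>n * t < 2 * \<tau>\<close> this gives
    \<open>8 * t < 1\<close>, hence \<open>4 * t^2 \<le> t / 2\<close>.\<close>
  moreover have "\<forall>\<^sub>F n in sequentially. 16 * \<tau> < real n"
    using filterlim_real_sequentially by (simp add: filterlim_at_top_dense)
  ultimately show "\<forall>\<^sub>F n in sequentially. norm (real (k n) / real n) \<le> ?b n"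
    using eventually_ge_at_top[of 3]
  proof eventually_elim
    case (elim n)
    have nonneg: "0 \<le> 4 / \<tau> * \<bar>real (k n) * mixing_coeff M X u n (l n)\<bar>" using \<tau> by simp
    show ?case
    proof (cases "l n = 0")
      case True
      have "real n * (8 * ?t n) = 8 * (real n * ?t n)" by simp
      also have "\<dots> < real n * 1" using elim by linarith
      finally have "real n * (8 * ?t n) < real n * 1" .
      then have "8 * ?t n < 1" using elim(4) by (subst (asm) mult_less_cancel_left_pos) auto
      then have "?t n * (8 * ?t n) \<le> ?t n * 1" by (intro mult_left_mono) auto
      then have "4 * (?t n)\<^sup>2 \<le> ?t n / 2" by (simp add: power2_eq_square)
      then have "?t n / 2 \<le> mixing_coeff M X u n (l n)"
        using mixing_coeff_0_ge[OF elim(4), of u] True by simp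
      then have "\<tau> / 4 \<le> real n * mixing_coeff M X u n (l n)"
        using elim(1) mult_left_mono[of "?t n / 2" "mixing_coeff M X u n (l n)" "real n"] by simp
      then have "1 / real n \<le> 4 / \<tau> * mixing_coeff M X u n (l n)"
        using \<tau> elim(4) by (simp add: field_simps)
      then have "real (k n) * (1 / real n) \<le> real (k n) * (4 / \<tau> * mixing_coeff M X u n (l n))"
        by (rule mult_left_mono) simp
      also have "\<dots> = 4 / \<tau> * (real (k n) * mixing_coeff M X u n (l n))" by simp
      also have "\<dots> \<le> 4 / \<tau> * \<bar>real (k n) * mixing_coeff M X u n (l n)\<bar>"
        using \<tau> by (intro mult_left_mono) auto
      finally show ?thesis using True by simp
    next
      case False
      then have "real (k n) * 1 / real n \<le> real (k n) * real (l n) / real n"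
        by (intro divide_right_mono mult_left_mono) auto
      then show ?thesis using nonneg by simp
    qed
  qed
  have "?b \<longlonglongrightarrow> 0 + 4 / \<tau> * \<bar>0\<bar>" by (intro tendsto_intros kl mix)
  then show "?b \<longlonglongrightarrow> 0" by simp
qed

lemma blocks_X:
  assumes "\<And>n. real n * \<P>(\<omega> in M. X 0 \<omega> > u n) \<le> c"
    and "\<And>n. 0 < k n" "filterlim k at_top sequentially"
    and "(\<lambda>n. real (k n) / real n) \<longlonglongrightarrow> 0" "(\<lambda>n. real (k n) * real (l n) / real n) \<longlonglongrightarrow> 0"
    and "(\<lambda>n. real (k n) * mixing_coeff M X u n (l n)) \<longlonglongrightarrow> 0"
  shows "blocks M X T u l k c"
proof unfold_locales
  show "real n * \<P>(\<omega> in M. X j \<omega> > u n) \<le> c" for n j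
    using assms(1)[of n] prob_X_eq[where j = j and c = "u n"] by simp
  show "\<P>(\<omega> in M. Q {j\<in>J. X (q * T + j) \<omega> > u n}) = \<P>(\<omega> in M. Q {j\<in>J. X j \<omega> > u n})"
    if "finite J" for n q J Q
    using that by (rule prob_X_pattern)
qed (use assms T_pos in auto)

lemma blocks_Y:
  assumes u: "\<And>n. 1 \<le> n \<Longrightarrow> 0 < u n"
    and c: "\<And>n. real n * \<P>(\<omega> in M. X 0 \<omega> > u n) \<le> c"
    and "\<And>n. 0 < k n" "filterlim k at_top sequentially"
    and "(\<lambda>n. real (k n) / real n) \<longlonglongrightarrow> 0" "(\<lambda>n. real (k n) * real (l n) / real n) \<longlonglongrightarrow> 0"
    and "(\<lambda>n. real (k n) * mixing_coeff M Y u n (l n)) \<longlonglongrightarrow> 0"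
  shows "blocks M Y T u l k (real (T + 1) * c)"
proof unfold_locales
  show "real n * \<P>(\<omega> in M. Y j \<omega> > u n) \<le> real (T + 1) * c" if "1 \<le> n" for n j
  proof -
    have "real n * \<P>(\<omega> in M. Y j \<omega> > u n) \<le> real n * (real (T + 1) * \<P>(\<omega> in M. X 0 \<omega> > u n))"
      using prob_Y_exceeds_le[OF u[OF that]] by (intro mult_left_mono) auto
    also have "\<dots> = real (T + 1) * (real n * \<P>(\<omega> in M. X 0 \<omega> > u n))" by (simp only: mult.left_commute)
    also have "\<dots> \<le> real (T + 1) * c" using c by (intro mult_left_mono) auto
    finally show ?thesis .
  qed
  show "\<P>(\<omega> in M. Q {j\<in>J. Y (q * T + j) \<omega> > u n}) = \<P>(\<omega> in M. Q {j\<in>J. Y j \<omega> > u n})"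
    if "1 \<le> n" "finite J" "0 \<notin> J" for n q J Q
    using u[OF that(1)] that(2,3) by (rule prob_Y_periodic)
qed (use assms T_pos in auto)

text \<open>Indices 1 and \<open>T\<close> each contribute the full exceedance probability of
  \<open>X 0\<close>: \<open>T\<close> always works, and a failure at 1 copies the always working
  index 0. Each of the \<open>T - 2\<close> indices between them contributes the share
  \<open>p\<close> of it, which gives the coefficient \<open>(T - 2) p + 2\<close>.\<close>

lemma exceedance_rate_Y:
  assumes u: "\<And>n. 1 \<le> n \<Longrightarrow> 0 < u n"
    and tauX: "(\<lambda>n. real n * \<P>(\<omega> in M. X 0 \<omega> > u n)) \<longlonglongrightarrow> \<tau>X"
    and tauj: "\<And>j. 2 \<le> j \<Longrightarrow> j \<le> T - 1 \<Longrightarrow>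
      (\<lambda>n. real n * \<P>(\<omega> in M. Max ((\<lambda>i. U i \<omega> * X i \<omega>) ` {0..j - 1}) > u n)) \<longlonglongrightarrow> \<tau>j j"
  shows "(\<lambda>n. real n / real T * (\<Sum>j=1..T. \<P>(\<omega> in M. Y j \<omega> > u n))) \<longlonglongrightarrow>
    1 / real T * ((real (T - 2) * p + 2) * \<tau>X + (1 - p) * (\<Sum>j=2..T - 1. \<tau>j j))"
proof -
  let ?t = "\<lambda>n. \<P>(\<omega> in M. X 0 \<omega> > u n)"
  let ?g = "\<lambda>j n. \<P>(\<omega> in M. Max ((\<lambda>i. U i \<omega> * X i \<omega>) ` {0..j - 1}) > u n)"
  have g1: "?g 1 n = ?t n" for n
  proof (rule prob_cong_AE)
    show "AE \<omega> in M. Max ((\<lambda>i. U i \<omega> * X i \<omega>) ` {0..1 - 1}) > u n \<longleftrightarrow> X 0 \<omega> > u n"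
      using U_0_T by eventually_elim simp
  qed measurable
  have eq: "real n / real T * (\<Sum>j=1..T. \<P>(\<omega> in M. Y j \<omega> > u n)) =
    1 / real T * ((real (T - 2) * p + 2) * (real n * ?t n) + (1 - p) * (\<Sum>j=2..T - 1. real n * ?g j n))"
    if "1 \<le> n" for n
  proof -
    have Yj: "\<P>(\<omega> in M. Y j \<omega> > u n) = p * ?t n + (1 - p) * ?g j n" if "1 \<le> j" "j < T" for j
      using u[OF \<open>1 \<le> n\<close>] that by (rule prob_Y_exceeds)
    have "{1..T} = insert 1 (insert T {2..T - 1})" using T_ge by auto
    then have "(\<Sum>j=1..T. \<P>(\<omega> in M. Y j \<omega> > u n)) =
      \<P>(\<omega> in M. Y 1 \<omega> > u n) + (\<P>(\<omega> in M. Y T \<omega> > u n) + (\<Sum>j=2..T - 1. \<P>(\<omega> in M. Y j \<omega> > u n)))"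
      using T_ge by (simp only:, subst sum.insert, simp, simp, subst sum.insert) auto
    also have "(\<Sum>j=2..T - 1. \<P>(\<omega> in M. Y j \<omega> > u n)) = (\<Sum>j=2..T - 1. p * ?t n + (1 - p) * ?g j n)"
      using T_ge by (intro sum.cong refl Yj) auto
    also have "\<dots> = real (T - 2) * (p * ?t n) + (1 - p) * (\<Sum>j=2..T - 1. ?g j n)"
    proof -
      have "card {2..T - 1} = T - 2" using T_ge by simp
      then show ?thesis by (simp only: sum.distrib sum_constant sum_distrib_left)
    qed
    also have "\<P>(\<omega> in M. Y 1 \<omega> > u n) = ?t n"
      using Yj[of 1] T_ge g1[of n] by (simp add: algebra_simps)
    also have "\<P>(\<omega> in M. Y T \<omega> > u n) = ?t n" by (rule prob_Y_T_exceeds[OF u[OF that]])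
    finally have sum: "(\<Sum>j=1..T. \<P>(\<omega> in M. Y j \<omega> > u n)) =
      ?t n + (?t n + (real (T - 2) * (p * ?t n) + (1 - p) * (\<Sum>j=2..T - 1. ?g j n)))" .
    show ?thesis
      unfolding sum sum_distrib_left[symmetric] by (simp only: times_divide_eq_left mult_1) (simp add: algebra_simps)
  qed
  have "\<forall>\<^sub>F n in sequentially.
    1 / real T * ((real (T - 2) * p + 2) * (real n * ?t n) + (1 - p) * (\<Sum>j=2..T - 1. real n * ?g j n)) =
    real n / real T * (\<Sum>j=1..T. \<P>(\<omega> in M. Y j \<omega> > u n))"
    by (rule eventually_sequentiallyI[of 1], rule eq[symmetric])
  moreover have "(\<lambda>n. 1 / real T * ((real (T - 2) * p + 2) * (real n * ?t n) +
      (1 - p) * (\<Sum>j=2..T - 1. real n * ?g j n))) \<longlonglongrightarrow>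
    1 / real T * ((real (T - 2) * p + 2) * \<tau>X + (1 - p) * (\<Sum>j=2..T - 1. \<tau>j j))"
    by (intro tendsto_intros tauX tauj) auto
  ultimately show ?thesis by (rule Lim_transform_eventually[rotated])
qed

lemma extremal_index_Y:
  assumes u: "\<And>n. 1 \<le> n \<Longrightarrow> 0 < u n"
    and tauX: "(\<lambda>n. real n * \<P>(\<omega> in M. X 0 \<omega> > u n)) \<longlonglongrightarrow> \<tau>X" "0 < \<tau>X" and "\<tau> \<noteq> 0"
    and k: "\<And>n. 0 < k n" "filterlim k at_top sequentially"
    and kl: "(\<lambda>n. real (k n) * real (l n) / real n) \<longlonglongrightarrow> 0"
    and k_mix: "(\<lambda>n. real (k n) * mixing_coeff M X u n (l n)) \<longlonglongrightarrow> 0"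
      "(\<lambda>n. real (k n) * mixing_coeff M Y u n (l n)) \<longlonglongrightarrow> 0"
    and theta_X: "has_extremal_index M X u \<tau>X \<theta>X"
    and local_dep: "(\<lambda>n. real n * clump (u n) (n div (k n * T) * T)) \<longlonglongrightarrow> 0"
    and lims1: "\<And>i. 1 \<le> i \<Longrightarrow> i \<le> T - 1 \<Longrightarrow> convergent (P_seq1 M X u p T i)"
    and lims2: "\<And>i. 1 \<le> i \<Longrightarrow> i \<le> T - 1 \<Longrightarrow> convergent (P_seq2 M X u p T i)"
  shows "has_extremal_index M Y u \<tau>
        (\<tau>X / (\<tau> * real T) * \<theta>X * (real (T - 1) * p ^ T + p ^ (T - 1))
         + 1 / (\<tau> * real T) * (\<Sum>i=1..T - 1. P_lim M X u p T i))"
proof -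
  let ?q = "\<lambda>n. \<P>(\<omega> in M. X 0 \<omega> > u n \<and> (\<forall>m\<in>{1..T}. X m \<omega> \<le> u n))"
  have k_small: "(\<lambda>n. real (k n) / real n) \<longlonglongrightarrow> 0"
    using tauX kl k_mix(1) by (rule k_over_n_tendsto_0)
  \<comment> \<open>A convergent sequence is bounded, which provides a single \<open>c\<close> for
    all \<open>n\<close>.\<close>
  obtain c where "\<And>n. norm (real n * \<P>(\<omega> in M. X 0 \<omega> > u n)) \<le> c"
    using convergent_imp_Bseq[OF convergentI[OF tauX(1)]] unfolding Bseq_def by blast
  then have c: "real n * \<P>(\<omega> in M. X 0 \<omega> > u n) \<le> c" for n
    by (simp add: abs_le_iff)
  interpret BX: blocks M X T u l k c
    using c k k_small kl k_mix(1) by (rule blocks_X)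
  interpret BY: blocks M Y T u l k "real (T + 1) * c"
    using u c k k_small kl k_mix(2) by (rule blocks_Y)
  \<comment> \<open>By stationarity all run-end probabilities of \<open>X\<close> coincide, so the
    average over a period collapses to \<open>n * ?q n\<close>.\<close>
  have X_run: "BX.run_end n i = ?q n" for n i
  proof -
    let ?Q = "\<lambda>E. 0 \<in> E \<and> (\<forall>m\<in>{1..T}. m \<notin> E)"
    have "BX.run_end n i = \<P>(\<omega> in M. ?Q {j\<in>{0..T}. X (i + j) \<omega> > u n})"
      unfolding BX.run_end_def ball_shift
      by (intro arg_cong[where f = prob] Collect_cong) (auto simp: not_less)
    also have "\<dots> = \<P>(\<omega> in M. ?Q {j\<in>{0..T}. X j \<omega> > u n})"
      by (rule prob_X_pattern) simp
    also have "\<dots> = ?q n"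
      by (intro arg_cong[where f = prob] Collect_cong) (auto simp: not_less)
    finally show ?thesis .
  qed
  have "(\<lambda>n. real n / real T * (\<Sum>i=1..T. BX.run_end n i)) \<longlonglongrightarrow> \<tau>X * \<theta>X"
    using theta_X X_return_le_clump tauX(2)
    by (subst BX.prob_max_tendsto_iff_run_ends[OF local_dep, symmetric])
      (auto simp: BX.blk_def has_extremal_index_iff)
  then have q: "(\<lambda>n. real n * ?q n) \<longlonglongrightarrow> \<tau>X * \<theta>X"
    using T_pos unfolding X_run by simp
  \<comment> \<open>\<open>?s / T\<close> is \<tau> times the extremal index claimed for
    \<open>Y\<close>.\<close>
  let ?s = "\<tau>X * \<theta>X * (real (T - 1) * p ^ T + p ^ (T - 1)) + (\<Sum>i=1..T - 1. P_lim M X u p T i)"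
  have "(\<lambda>n. real n / real T * (\<Sum>i=1..T. BY.run_end n i)) \<longlonglongrightarrow> 1 / real T * ?s"
  proof (rule Lim_transform_eventually)
    let ?f = "\<lambda>n. 1 / real T * ((\<Sum>i=1..T - 1. P_seq1 M X u p T i n + P_seq2 M X u p T i n + p ^ T * (real n * ?q n)) +
      p ^ (T - 1) * (real n * ?q n))"
    have "?f \<longlonglongrightarrow> 1 / real T * ((\<Sum>i=1..T - 1. lim (P_seq1 M X u p T i) + lim (P_seq2 M X u p T i) + p ^ T * (\<tau>X * \<theta>X)) +
      p ^ (T - 1) * (\<tau>X * \<theta>X))"
      using lims1 lims2 by (intro tendsto_intros q) (auto simp: convergent_LIMSEQ_iff)
    moreover have "(\<Sum>i=1..T - 1. lim (P_seq1 M X u p T i) + lim (P_seq2 M X u p T i) + p ^ T * (\<tau>X * \<theta>X)) +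
      p ^ (T - 1) * (\<tau>X * \<theta>X) = ?s"
      by (simp add: P_lim_def sum.distrib algebra_simps)
    ultimately show "?f \<longlonglongrightarrow> 1 / real T * ?s" by simp
    show "\<forall>\<^sub>F n in sequentially. ?f n = real n / real T * (\<Sum>i=1..T. BY.run_end n i)"
    proof (rule eventually_sequentiallyI[of 1])
      fix n :: nat assume "1 \<le> n"
      note u = u[OF this]
      have "{1..T} = insert T {1..T - 1}" using T_ge by auto
      then have "real n * (\<Sum>i=1..T. BY.run_end n i) =
        real n * BY.run_end n T + (\<Sum>i=1..T - 1. real n * BY.run_end n i)"
        using T_ge by (simp only:, subst sum.insert) (auto simp: distrib_left sum_distrib_left)
      also have "(\<Sum>i=1..T - 1. real n * BY.run_end n i) =
        (\<Sum>i=1..T - 1. P_seq1 M X u p T i n + P_seq2 M X u p T i n + p ^ T * (real n * ?q n))"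
        unfolding BY.run_end_def using u T_ge by (intro sum.cong refl run_end_Y_P_seq) auto
      also have "real n * BY.run_end n T = p ^ (T - 1) * (real n * ?q n)"
        unfolding BY.run_end_def prob_Y_run_end_T[OF u] by simp
      finally show "?f n = real n / real T * (\<Sum>i=1..T. BY.run_end n i)"
        by (simp only: times_divide_eq_left mult_1 add.commute)
    qed
  qed
  then have "(\<lambda>n. \<P>(\<omega> in M. \<forall>j\<in>{1..n}. Y j \<omega> \<le> u n)) \<longlonglongrightarrow> exp (- (1 / real T * ?s))"
    using Y_return_le_clump[OF u]
    by (subst BY.prob_max_tendsto_iff_run_ends[OF local_dep]) (auto simp: BY.blk_def)
  also have "1 / real T * ?s = \<tau> * (\<tau>X / (\<tau> * real T) * \<theta>X * (real (T - 1) * p ^ T + p ^ (T - 1))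
         + 1 / (\<tau> * real T) * (\<Sum>i=1..T - 1. P_lim M X u p T i))"
    using \<open>\<tau> \<noteq> 0\<close> T_pos by (simp add: field_simps)
  finally show ?thesis using \<open>\<tau> \<noteq> 0\<close> by (simp add: has_extremal_index_iff)
qed

end

theorem theorem3p3:
  fixes M :: "'w measure"
    and U X Y :: "nat \<Rightarrow> 'w \<Rightarrow> real"
    and T :: nat and p :: real
    and F :: "real \<Rightarrow> real" and G :: "nat \<Rightarrow> real \<Rightarrow> real"
    and u :: "nat \<Rightarrow> real"
    and \<tau>X \<tau> \<theta>X :: real and \<tau>j :: "nat \<Rightarrow> real"
    and l k :: "nat \<Rightarrow> nat"
  assumes "prob_space M"
    and "T \<ge> 2" and "0 < p" and "p < 1"
    and U_indep: "prob_space.indep_vars M (\<lambda>_. borel) U UNIV"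
    and U_one: "\<And>m. AE \<omega> in M. U (m * T) \<omega> = 1"
    and U_bernoulli: "\<And>n. \<not> T dvd n \<Longrightarrow>
           distr M borel (U n) = distr (measure_pmf (bernoulli_pmf p)) borel of_bool"
    and X_stationary: "strictly_stationary M X"
    and X_pos: "\<And>n. AE \<omega> in M. X n \<omega> > 0"
    and F_def: "F = cdf (distr M borel (X 0))"
    and F_cont: "continuous_on UNIV F"
    and XU_indep: "prob_space.indep_var M
           (PiM UNIV (\<lambda>_. borel)) (\<lambda>\<omega> n. X n \<omega>) (PiM UNIV (\<lambda>_. borel)) (\<lambda>\<omega> n. U n \<omega>)"
    and Y_def: "Y = failure_seq T U X"
    and u_pos: "\<And>n. n \<ge> 1 \<Longrightarrow> u n > 0"
    and "\<tau>X > 0"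
    and tauX: "(\<lambda>n. real n * (1 - F (u n))) \<longlonglongrightarrow> \<tau>X"
    and G_def: "\<And>j. G j = cdf (distr M borel (\<lambda>\<omega>. Max ((\<lambda>i. U i \<omega> * X i \<omega>) ` {0..j - 1})))"
    and tauj: "\<And>j. 2 \<le> j \<Longrightarrow> j \<le> T - 1 \<Longrightarrow> (\<lambda>n. real n * (1 - G j (u n))) \<longlonglongrightarrow> \<tau>j j"
    and tau_def: "\<tau> = 1 / real T *
           ((real (T - 2) * p + 2) * \<tau>X + (1 - p) * (\<Sum>j=2..T - 1. \<tau>j j))"
    and D_X: "condition_D_with M X u l"
    and D_Y: "condition_D_with M Y u l"
    and k_pos: "\<And>n. k n > 0"
    and k_inf: "filterlim k at_top sequentially"
    and kl: "(\<lambda>n. real (k n) * real (l n) / real n) \<longlonglongrightarrow> 0"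
    and k_mix_X: "(\<lambda>n. real (k n) * mixing_coeff M X u n (l n)) \<longlonglongrightarrow> 0"
    and k_mix_Y: "(\<lambda>n. real (k n) * mixing_coeff M Y u n (l n)) \<longlonglongrightarrow> 0"
    and theta_X: "has_extremal_index M X u \<tau>X \<theta>X"
    and local_dep: "(\<lambda>n. real n *
           \<P>(\<omega> in M. seq_max X {0..T} \<omega> > ereal (u n) \<and> u n \<ge> X (T + 1) \<omega>
              \<and> seq_max X {T + 2..n div (k n * T) * T + T} \<omega> > ereal (u n))) \<longlonglongrightarrow> 0"
    and lims1: "\<And>i. 1 \<le> i \<Longrightarrow> i \<le> T - 1 \<Longrightarrow> convergent (P_seq1 M X u p T i)"
    and lims2: "\<And>i. 1 \<le> i \<Longrightarrow> i \<le> T - 1 \<Longrightarrow> convergent (P_seq2 M X u p T i)"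
  shows "(\<lambda>n. real n / real T * (\<Sum>j=1..T. \<P>(\<omega> in M. Y j \<omega> > u n))) \<longlonglongrightarrow> \<tau>
    \<and> has_extremal_index M Y u \<tau>
        (\<tau>X / (\<tau> * real T) * \<theta>X * (real (T - 1) * p ^ T + p ^ (T - 1))
         + 1 / (\<tau> * real T) * (\<Sum>i=1..T - 1. P_lim M X u p T i))"
proof -
  interpret failure_model M U X T p
    using \<open>prob_space M\<close> \<open>T \<ge> 2\<close> \<open>0 < p\<close> \<open>p < 1\<close> U_indep U_one U_bernoulli X_stationary XU_indep
    by (intro failure_model.intro failure_model_axioms.intro)
  have tX: "(\<lambda>n. real n * \<P>(\<omega> in M. X 0 \<omega> > u n)) \<longlonglongrightarrow> \<tau>X"
    using tauX unfolding F_def by (simp add: one_minus_cdf)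
  have tj: "(\<lambda>n. real n * \<P>(\<omega> in M. Max ((\<lambda>i. U i \<omega> * X i \<omega>) ` {0..j - 1}) > u n)) \<longlonglongrightarrow> \<tau>j j"
    if "2 \<le> j" "j \<le> T - 1" for j
    using tauj[OF that] unfolding G_def by (subst (asm) one_minus_cdf) simp_all
  \<comment> \<open>As limits of nonnegative terms the \<open>\<tau>j j\<close> are nonnegative; so
    \<tau> is positive and division by it is legitimate.\<close>
  have "0 \<le> \<tau>j j" if "2 \<le> j" "j \<le> T - 1" for j
    using tj[OF that] by (rule LIMSEQ_le_const) (auto intro!: exI[of _ 0])
  then have "0 \<le> (\<Sum>j=2..T - 1. \<tau>j j)" by (intro sum_nonneg) auto
  moreover have "0 < real (T - 2) * p + 2" using \<open>0 < p\<close> by (intro add_nonneg_pos) auto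
  ultimately have "0 < (real (T - 2) * p + 2) * \<tau>X + (1 - p) * (\<Sum>j=2..T - 1. \<tau>j j)"
    using \<open>p < 1\<close> \<open>\<tau>X > 0\<close> by (simp add: add_pos_nonneg)
  then have "\<tau> \<noteq> 0" using T_pos unfolding tau_def by simp
  have "(\<lambda>n. real n * clump (u n) (n div (k n * T) * T)) \<longlonglongrightarrow> 0"
    using local_dep unfolding clump_def less_seq_max_iff .
  then have "has_extremal_index M Y u \<tau>
        (\<tau>X / (\<tau> * real T) * \<theta>X * (real (T - 1) * p ^ T + p ^ (T - 1))
         + 1 / (\<tau> * real T) * (\<Sum>i=1..T - 1. P_lim M X u p T i))"
    using u_pos tX \<open>\<tau>X > 0\<close> \<open>\<tau> \<noteq> 0\<close> k_pos k_inf kl k_mix_X k_mix_Y theta_X lims1 lims2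
    unfolding Y_def by (intro extremal_index_Y)
  moreover have "(\<lambda>n. real n / real T * (\<Sum>j=1..T. \<P>(\<omega> in M. Y j \<omega> > u n))) \<longlonglongrightarrow> \<tau>"
    unfolding Y_def tau_def using u_pos tX tj by (rule exceedance_rate_Y)
  ultimately show ?thesis by simp
qed

end
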